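(* Consider a two-dimensional singularly perturbed dynamical system $\varepsilon \dot x = f(x,y)$, $\dot y = g(x,y)$, with $0<\varepsilon\ll 1$, $x,y\in\mathbb{R}$ and $f,g$ of class $C^\infty$, and let its slow invariant manifold be the graph $y=F(x,\varepsilon)$ with perturbation expansion $F(x,\varepsilon)=F_0(x)+\varepsilon F_1(x)+\varepsilon^2F_2(x)+\cdots$. Let $\phi_1(x,y,\varepsilon)=\det(\dot{\vec X},\ddot{\vec X})$ with $\vec X=(x,y)^t$, and for $i\ge 1$ let $\phi_i(x,y,\varepsilon)=\frac{d^{\,i-1}}{dt^{\,i-1}}[\phi_1(x,y,\varepsilon)]$ be the $(i-1)$-th time derivative of $\phi_1$ along the solutions of the system. For $i\ge 1$ set $$a_{10}^{(i)}(x,\varepsilon)=-\left.\frac{\partial\phi_i/\partial x}{\partial\phi_i/\partial y}\right|_{y=F(x,\varepsilon)},\qquad a_{01}^{(i)}(x,\varepsilon)=-\left.\frac{\partial\phi_i/\partial\varepsilon}{\partial\phi_i/\partial y}\right|_{y=F(x,\varepsilon)}.$$ Then the functions $F_n(x)$ of the slow invariant manifold are given, at points $x$ where the expressions below are well defined, by $$F_n'(x)=\lim_{\varepsilon\to0}\left[\frac1{n!}\frac{\partial^n a_{10}^{(i)}}{\partial\varepsilon^n}(x,\varepsilon)\right]\quad\text{for } n\ge 0,\ \text{with } i=\max(n,1),$$ $$F_n(x)=\lim_{\varepsilon\to0}\left[\frac1{n!}\frac{\partial^{n-1} a_{01}^{(n)}}{\partial\varepsilon^{n-1}}(x,\varepsilon)\right]\quad\text{for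 } n\ge 1.$$
   Context: The dot, equivalently $d/dt$ in the definition of $\phi_i$, denotes the derivative along solutions with respect to the time variable of the system $\varepsilon\dot x=f(x,y)$, $\dot y=g(x,y)$. All time derivatives are expressed as functions of $(x,y,\varepsilon)$, $\varepsilon>0$, by means of the vector field: $\dot{\vec X}=(f(x,y)/\varepsilon,\ g(x,y))^t$, $\ddot{\vec X}$ is the derivative of $\dot{\vec X}$ along the flow, and for a function $\psi(x,y,\varepsilon)$, $\frac{d\psi}{dt}=\frac{f}{\varepsilon}\frac{\partial\psi}{\partial x}+g\frac{\partial\psi}{\partial y}$. The graph $y=F(x,\varepsilon)$ is a slow invariant manifold: it is locally invariant under the flow, i.e. $\frac{\partial F}{\partial x}(x,\varepsilon)\,f(x,F(x,\varepsilon))=\varepsilon\,g(x,F(x,\varepsilon))$, and for $\varepsilon=0$ it reduces to the critical manifold, $f(x,F_0(x))=0$. It is assumed that $\partial f/\partial y$ is nonzero along the critical manifold (so that $F_0$ is given by the implicit function theorem) and that $F_0'$ is nonzero almost everywhere. $F$ is assumed to admit the expansion $F(x,\varepsilon)=\sum_{i=0}^{N-1}F_i(x)\varepsilon^i+O(\varepsilon^N)$, which may be differentiated term by term in $x$ and $\varepsilon$. In $\partial^n a_{10}^{(i)}/\partial\varepsilon^n$ and $\partial^{n-1}a_{01}^{(n)}/\partial\varepsilon^{n-1}$, the functions $a_{10}^{(i)}$ and $a_{01}^{(n)}$ are regarded as functions of $(x,\varepsilon)$ after substituting $y=F(x,\varepsilon)$.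
   Formalization: "Well defined" at x is read as: the denominator ∂φ_i/∂y on y=F is nonzero for all small ε>0, and F_0'(x)≠0; without the latter the formula fails, e.g. f=y−x², g=x+x²+y, F=x²+ε(1/2+x), at x=0 with n=1. *)

theory Defs
  imports "HOL-Analysis.Analysis" "HOL-Library.Landau_Symbols"
begin

definition D1 :: "(real \<Rightarrow> real \<Rightarrow> real) \<Rightarrow> real \<Rightarrow> real \<Rightarrow> real" where
  "D1 h u v = deriv (\<lambda>s. h s v) u"

definition D2 :: "(real \<Rightarrow> real \<Rightarrow> real) \<Rightarrow> real \<Rightarrow> real \<Rightarrow> real" where
  "D2 h u v = deriv (\<lambda>s. h u s) v"

primrec Ck_on :: "nat \<Rightarrow> (real \<times> real) set \<Rightarrow> (real \<Rightarrow> real \<Rightarrow> real) \<Rightarrow> bool" where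
  "Ck_on 0 S h = continuous_on S (\<lambda>(u, v). h u v)"
| "Ck_on (Suc k) S h =
     ((\<forall>(u, v)\<in>S. (\<lambda>s. h s v) differentiable (at u) \<and> (\<lambda>s. h u s) differentiable (at v))
      \<and> Ck_on k S (D1 h) \<and> Ck_on k S (D2 h))"

text \<open>Used for open sets only: the partial derivatives are two-sided, and the continuity of \<open>h\<close>
  itself then follows from that of its partial derivatives.\<close>

definition smooth2_on :: "(real \<times> real) set \<Rightarrow> (real \<Rightarrow> real \<Rightarrow> real) \<Rightarrow> bool" where
  "smooth2_on S h \<longleftrightarrow> (\<forall>k. Ck_on k S h)"

definition smooth1_on :: "real set \<Rightarrow> (real \<Rightarrow> real) \<Rightarrow> bool" where
  "smooth1_on S h \<longleftrightarrow> (\<forall>k. \<forall>u\<in>S. (deriv ^^ k) h differentiable (at u))"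

text \<open>Functions \<open>\<psi> x y e\<close> of the phase variables \<open>x\<close>, \<open>y\<close> and of the small parameter \<open>e\<close>.\<close>

definition dx :: "(real \<Rightarrow> real \<Rightarrow> real \<Rightarrow> real) \<Rightarrow> real \<Rightarrow> real \<Rightarrow> real \<Rightarrow> real" where
  "dx \<psi> x y e = deriv (\<lambda>s. \<psi> s y e) x"

definition dy :: "(real \<Rightarrow> real \<Rightarrow> real \<Rightarrow> real) \<Rightarrow> real \<Rightarrow> real \<Rightarrow> real \<Rightarrow> real" where
  "dy \<psi> x y e = deriv (\<lambda>s. \<psi> x s e) y"

definition de :: "(real \<Rightarrow> real \<Rightarrow> real \<Rightarrow> real) \<Rightarrow> real \<Rightarrow> real \<Rightarrow> real \<Rightarrow> real" where
  "de \<psi> x y e = deriv (\<lambda>s. \<psi> x y s) e"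

text \<open>Derivative along the solutions of \<open>e * x' = f x y\<close>, \<open>y' = g x y\<close>.\<close>

definition time_deriv ::
  "(real \<Rightarrow> real \<Rightarrow> real) \<Rightarrow> (real \<Rightarrow> real \<Rightarrow> real) \<Rightarrow>
   (real \<Rightarrow> real \<Rightarrow> real \<Rightarrow> real) \<Rightarrow> real \<Rightarrow> real \<Rightarrow> real \<Rightarrow> real" where
  "time_deriv f g \<psi> x y e = f x y / e * dx \<psi> x y e + g x y * dy \<psi> x y e"

definition velocity ::
  "(real \<Rightarrow> real \<Rightarrow> real) \<Rightarrow> (real \<Rightarrow> real \<Rightarrow> real) \<Rightarrow> real \<Rightarrow> real \<Rightarrow> real \<Rightarrow> real^2" where
  "velocity f g x y e = vector [f x y / e, g x y]"

definition acceleration ::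
  "(real \<Rightarrow> real \<Rightarrow> real) \<Rightarrow> (real \<Rightarrow> real \<Rightarrow> real) \<Rightarrow> real \<Rightarrow> real \<Rightarrow> real \<Rightarrow> real^2" where
  "acceleration f g x y e = (\<chi> j. time_deriv f g (\<lambda>x y e. velocity f g x y e $ j) x y e)"

text \<open>Indexed from 1; the value at \<open>i = 0\<close> (which is that at \<open>i = 1\<close>) is not used.\<close>

definition phi ::
  "(real \<Rightarrow> real \<Rightarrow> real) \<Rightarrow> (real \<Rightarrow> real \<Rightarrow> real) \<Rightarrow> nat \<Rightarrow> real \<Rightarrow> real \<Rightarrow> real \<Rightarrow> real" where
  "phi f g i = (time_deriv f g ^^ (i - 1))
     (\<lambda>x y e. det (transpose (vector [velocity f g x y e, acceleration f g x y e] :: real^2^2)))"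

definition a10 ::
  "(real \<Rightarrow> real \<Rightarrow> real) \<Rightarrow> (real \<Rightarrow> real \<Rightarrow> real) \<Rightarrow> (real \<Rightarrow> real \<Rightarrow> real) \<Rightarrow> nat \<Rightarrow> real \<Rightarrow> real \<Rightarrow> real" where
  "a10 f g F i x e = - (dx (phi f g i) x (F x e) e / dy (phi f g i) x (F x e) e)"

definition a01 ::
  "(real \<Rightarrow> real \<Rightarrow> real) \<Rightarrow> (real \<Rightarrow> real \<Rightarrow> real) \<Rightarrow> (real \<Rightarrow> real \<Rightarrow> real) \<Rightarrow> nat \<Rightarrow> real \<Rightarrow> real \<Rightarrow> real" where
  "a01 f g F i x e = - (de (phi f g i) x (F x e) e / dy (phi f g i) x (F x e) e)"

text \<open>\<open>F x e = (\<Sum>i<N. Fc i x * e ^ i) + O(e ^ N)\<close> for every \<open>N\<close>, as \<open>e\<close> tends to \<open>0\<close> through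
  positive values, differentiable term by term any number of times in \<open>x\<close> and in \<open>e\<close>; each
  derivative in \<open>e\<close> lowers the order of the remainder by one. The estimates are required for each
  fixed \<open>x\<close>, without uniformity in \<open>x\<close>.\<close>

definition has_expansion ::
  "real set \<Rightarrow> (real \<Rightarrow> real \<Rightarrow> real) \<Rightarrow> (nat \<Rightarrow> real \<Rightarrow> real) \<Rightarrow> bool" where
  "has_expansion I F Fc \<longleftrightarrow>
     (\<forall>N k l. \<forall>x\<in>I. l \<le> N \<longrightarrow>
        (\<lambda>e. (D1 ^^ k) ((D2 ^^ l) F) x e
              - (\<Sum>i<N. (D1 ^^ k) ((D2 ^^ l) (\<lambda>x e. Fc i x * e ^ i)) x e))
        \<in> O[at_right 0](\<lambda>e. e ^ (N - l)))"

text \<open>The graph \<open>y = F x e\<close>, \<open>x \<in> I\<close>, \<open>0 \<le> e < e0\<close>, is a slow invariant manifold with expansion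
  coefficients \<open>Fc\<close>.\<close>

definition slow_invariant_manifold ::
  "(real \<Rightarrow> real \<Rightarrow> real) \<Rightarrow> (real \<Rightarrow> real \<Rightarrow> real) \<Rightarrow> real set \<Rightarrow> real \<Rightarrow>
   (real \<Rightarrow> real \<Rightarrow> real) \<Rightarrow> (nat \<Rightarrow> real \<Rightarrow> real) \<Rightarrow> bool" where
  "slow_invariant_manifold f g I e0 F Fc \<longleftrightarrow>
     open I \<and> 0 < e0
   \<and> smooth2_on (I \<times> {0<..<e0}) F
   \<and> (\<forall>n. smooth1_on I (Fc n))
   \<and> has_expansion I F Fc
   \<and> (\<forall>x\<in>I. \<forall>e\<in>{0<..<e0}. D1 F x e * f x (F x e) = e * g x (F x e))
   \<and> (\<forall>x\<in>I. F x 0 = Fc 0 x \<and> f x (Fc 0 x) = 0)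
   \<and> (\<forall>x\<in>I. D2 f x (Fc 0 x) \<noteq> 0)
   \<and> (AE x in lborel. x \<in> I \<longrightarrow> deriv (Fc 0) x \<noteq> 0)"

end

theory Submission
  imports Defs
begin

text \<open>The product \<open>e ^ (i + 1) * phi f g i\<close> is a polynomial in \<open>e\<close> with smooth coefficients
  in \<open>x\<close>, \<open>y\<close>; at \<open>e = 0\<close> its \<open>y\<close>-derivative on the critical manifold is
  \<open>- f\<^sub>y * g * f\<^sub>x ^ i\<close>. This is nonzero, because \<open>f\<^sub>x = - f\<^sub>y * F\<^sub>0'\<close>, and \<open>g = 0\<close> would make the
  point an equilibrium, where the gradient of \<open>phi f g i\<close> vanishes. On the graph, on the other hand,
  \<open>w = phi f g i\<close> is an expression in \<open>u = f / e = g / F\<^sub>x\<close>, \<open>g\<close> and their \<open>x\<close>-derivatives, so \<open>w\<close> and all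
  its derivatives stay bounded as \<open>e\<close> tends to \<open>0\<close>. By the chain rule
  \<open>a10 = F\<^sub>x - w\<^sub>x / phi\<^sub>y\<close> and \<open>a01 = F\<^sub>e - w\<^sub>e / phi\<^sub>y\<close>, where both corrections are \<open>e ^ (i + 1)\<close> times a
  function with bounded derivatives. They do not contribute to the first \<open>i\<close> derivatives in \<open>e\<close>
  at \<open>e = 0\<close>.\<close>

section \<open>Partial derivatives and \<open>C\<^sup>k\<close> functions of two variables\<close>

lemma eventually_slice:
  assumes "open S" "(u, v) \<in> S"
  shows "\<forall>\<^sub>F s in nhds u. (s, v) \<in> S" and "\<forall>\<^sub>F s in nhds v. (u, s) \<in> S"
proof -
  have "open ((\<lambda>s. (s, v)) -` S)" "open ((\<lambda>s. (u, s)) -` S)"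
    using assms(1) by (auto intro!: open_vimage continuous_intros)
  then show "\<forall>\<^sub>F s in nhds u. (s, v) \<in> S" and "\<forall>\<^sub>F s in nhds v. (u, s) \<in> S"
    using assms(2) by (auto simp: eventually_nhds)
qed

lemma D_cong:
  assumes "open S" "(u, v) \<in> S" "\<And>a b. (a, b) \<in> S \<Longrightarrow> h a b = k a b"
  shows "D1 h u v = D1 k u v" and "D2 h u v = D2 k u v"
  unfolding D1_def D2_def
  by (rule deriv_cong_ev; use eventually_slice[OF assms(1,2)] assms(3) in
      \<open>force elim: eventually_mono\<close>)+

lemma Ck_on_SucD:
  assumes "Ck_on (Suc k) S h" "(u, v) \<in> S"
  shows "((\<lambda>s. h s v) has_real_derivative D1 h u v) (at u)"
    and "((\<lambda>s. h u s) has_real_derivative D2 h u v) (at v)"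
  using assms by (auto simp: D1_def D2_def DERIV_deriv_iff_real_differentiable)

lemma Ck_on_Suc_D:
  assumes "Ck_on (Suc k) S h"
  shows "Ck_on k S (D1 h)" and "Ck_on k S (D2 h)"
  using assms by simp_all

lemma Ck_on_SucI:
  assumes "\<And>u v. (u, v) \<in> S \<Longrightarrow> ((\<lambda>s. h s v) has_real_derivative h1 u v) (at u)"
    and "\<And>u v. (u, v) \<in> S \<Longrightarrow> ((\<lambda>s. h u s) has_real_derivative h2 u v) (at v)"
    and "Ck_on k S (D1 h)" "Ck_on k S (D2 h)"
  shows "Ck_on (Suc k) S h"
  using assms by (auto simp: real_differentiable_def; blast)

lemma D_eqI:
  "((\<lambda>s. h s v) has_real_derivative a) (at u) \<Longrightarrow> D1 h u v = a"
  "((\<lambda>s. h u s) has_real_derivative b) (at v) \<Longrightarrow> D2 h u v = b"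
  by (simp_all add: D1_def D2_def DERIV_imp_deriv)

lemma C1_has_derivative:
  assumes "open S" "Ck_on (Suc 0) S h" "(u, v) \<in> S"
  shows "((\<lambda>(a, b). h a b) has_derivative (\<lambda>(a, b). D1 h u v * a + D2 h u v * b)) (at (u, v))"
proof -
  obtain X Y where XY: "open X" "open Y" "u \<in> X" "v \<in> Y" "X \<times> Y \<subseteq> S"
    using open_prod_elim[OF assms(1,3)] by (metis mem_Sigma_iff)
  obtain r where r: "r > 0" "ball v r \<subseteq> Y"
    using XY openE by metis
  let ?Y = "ball v r"
  have sub: "X \<times> ?Y \<subseteq> S" using XY r by auto
  have at: "at (u, v) within X \<times> ?Y = at (u, v)"
    using XY r by (intro at_within_open) (auto intro: open_Times)
  have c: "continuous_on (X \<times> ?Y) (\<lambda>(a, b). D2 h a b)"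
    using assms(2) sub continuous_on_subset by auto
  have "((\<lambda>(a, b). h a b) has_derivative
      (\<lambda>(a, b). D1 h u v * a + blinfun_apply (blinfun_mult_right (D2 h u v)) b)) (at (u, v) within X \<times> ?Y)"
  proof (rule has_derivative_partialsI)
    show "((\<lambda>x. h x v) has_derivative (*) (D1 h u v)) (at u within X)"
      using Ck_on_SucD(1)[OF assms(2,3)] has_derivative_at_withinI
      unfolding has_field_derivative_def by blast
    show "((\<lambda>y. h x y) has_derivative blinfun_apply (blinfun_mult_right (D2 h x y))) (at y within ?Y)"
      if "x \<in> X" "y \<in> ?Y" for x y
      using Ck_on_SucD(2)[OF assms(2), of x y] that sub has_derivative_at_withinI
      unfolding has_field_derivative_def blinfun_mult_right.rep_eq by blast
    have "continuous (at (u, v) within X \<times> ?Y) (\<lambda>(a, b). D2 h a b)"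
      using c XY r by (simp add: continuous_on_eq_continuous_within)
    then show "continuous (at (u, v) within X \<times> ?Y) (\<lambda>(x, y). blinfun_mult_right (D2 h x y))"
      unfolding split_beta' using bounded_linear.continuous bounded_linear_blinfun_mult_right by blast
  qed (use r in auto)
  then show ?thesis by (simp add: at)
qed

lemma Ck_on_continuous:
  assumes "open S" "Ck_on k S h"
  shows "continuous_on S (\<lambda>(u, v). h u v)"
  using assms(2)
proof (induction k arbitrary: h)
  case (Suc k)
  then have "Ck_on (Suc 0) S h" by simp
  then have "continuous (at (u, v)) (\<lambda>(u, v). h u v)" if "(u, v) \<in> S" for u v
    using C1_has_derivative[OF assms(1) _ that] has_derivative_continuous by blast
  then show ?case
    using assms(1) by (auto simp: continuous_on_eq_continuous_at)
qed simp

lemma Ck_on_Suc_imp: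
  assumes "open S" shows "Ck_on (Suc k) S h \<Longrightarrow> Ck_on k S h"
proof (induction k arbitrary: h)
  case 0
  then show ?case using Ck_on_continuous[OF assms 0] by simp
next
  case (Suc k)
  have "Ck_on k S (D1 h)" "Ck_on k S (D2 h)"
    by (rule Suc.IH, rule Ck_on_Suc_D[OF Suc.prems])+
  then show ?case
    by (intro Ck_on_SucI[OF Ck_on_SucD[OF Suc.prems]])
qed

lemma Ck_on_cong:
  assumes "open S"
  shows "Ck_on k S h \<Longrightarrow> (\<And>u v. (u, v) \<in> S \<Longrightarrow> h u v = j u v) \<Longrightarrow> Ck_on k S j"
proof (induction k arbitrary: h j)
  case 0
  have "continuous_on S (\<lambda>(u, v). h u v) \<longleftrightarrow> continuous_on S (\<lambda>(u, v). j u v)"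
    by (rule continuous_on_cong) (use 0(2) in auto)
  then show ?case using 0(1) by simp
next
  case (Suc k)
  have eq: "D1 h u v = D1 j u v" "D2 h u v = D2 j u v" if "(u, v) \<in> S" for u v
    using D_cong[OF assms that] Suc.prems(2) by blast+
  have "((\<lambda>s. j s v) has_real_derivative D1 h u v) (at u)" if uv: "(u, v) \<in> S" for u v
    using Ck_on_SucD(1)[OF Suc.prems(1) uv]
    by (rule DERIV_cong_ev[THEN iffD1, OF refl _ refl, rotated])
       (use eventually_slice[OF assms uv] Suc.prems(2) in \<open>force elim: eventually_mono\<close>)
  moreover have "((\<lambda>s. j u s) has_real_derivative D2 h u v) (at v)" if uv: "(u, v) \<in> S" for u v
    using Ck_on_SucD(2)[OF Suc.prems(1) uv]
    by (rule DERIV_cong_ev[THEN iffD1, OF refl _ refl, rotated])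
       (use eventually_slice[OF assms uv] Suc.prems(2) in \<open>force elim: eventually_mono\<close>)
  moreover have "Ck_on k S (D1 j)" "Ck_on k S (D2 j)"
    using Suc.IH[of "D1 h" "D1 j"] Suc.IH[of "D2 h" "D2 j"] Suc.prems(1) eq by auto
  ultimately show ?case by (rule Ck_on_SucI)
qed

lemma Ck_on_SucI':
  assumes "open S"
    and "\<And>u v. (u, v) \<in> S \<Longrightarrow> ((\<lambda>s. h s v) has_real_derivative h1 u v) (at u)"
    and "\<And>u v. (u, v) \<in> S \<Longrightarrow> ((\<lambda>s. h u s) has_real_derivative h2 u v) (at v)"
    and "Ck_on k S h1" "Ck_on k S h2"
  shows "Ck_on (Suc k) S h"
  using assms(2,3)
  proof (rule Ck_on_SucI)
  show "Ck_on k S (D1 h)"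
    by (rule Ck_on_cong[OF assms(1,4)]) (simp add: D_eqI(1)[OF assms(2)])
  show "Ck_on k S (D2 h)"
    by (rule Ck_on_cong[OF assms(1,5)]) (simp add: D_eqI(2)[OF assms(3)])
qed

lemma Ck_on_subset: "T \<subseteq> S \<Longrightarrow> Ck_on k S h \<Longrightarrow> Ck_on k T h"
  by (induction k arbitrary: h) (auto intro: continuous_on_subset)

lemma Ck_on_const: "open S \<Longrightarrow> Ck_on k S (\<lambda>u v. c)"
proof (induction k arbitrary: c)
  case (Suc k)
  then show ?case by (intro Ck_on_SucI'[where ?h1.0 = "\<lambda>u v. 0" and ?h2.0 = "\<lambda>u v. 0"]) auto
qed simp

lemma Ck_on_proj:
  assumes "open S" shows "Ck_on k S (\<lambda>u v. u)" and "Ck_on k S (\<lambda>u v. v)"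
proof -
  have "Ck_on (Suc k) S (\<lambda>u v. u)"
    by (rule Ck_on_SucI'[where ?h1.0 = "\<lambda>u v. 1" and ?h2.0 = "\<lambda>u v. 0"]) (auto intro!: Ck_on_const assms)
  then show "Ck_on k S (\<lambda>u v. u)" using Ck_on_Suc_imp[OF assms] by blast
  have "Ck_on (Suc k) S (\<lambda>u v. v)"
    by (rule Ck_on_SucI'[where ?h1.0 = "\<lambda>u v. 0" and ?h2.0 = "\<lambda>u v. 1"]) (auto intro!: Ck_on_const assms)
  then show "Ck_on k S (\<lambda>u v. v)" using Ck_on_Suc_imp[OF assms] by blast
qed

lemma Ck_on_add:
  assumes "open S"
  shows "Ck_on k S h \<Longrightarrow> Ck_on k S j \<Longrightarrow> Ck_on k S (\<lambda>u v. h u v + j u v)"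
proof (induction k arbitrary: h j)
  case 0
  then show ?case
    using continuous_on_add[of S "\<lambda>p. h (fst p) (snd p)" "\<lambda>p. j (fst p) (snd p)"] by (simp add: split_beta')
next
  case (Suc k)
  have h: "Ck_on k S (D1 h)" "Ck_on k S (D2 h)" and j: "Ck_on k S (D1 j)" "Ck_on k S (D2 j)"
    using Suc.prems by auto
  show ?case
    by (rule Ck_on_SucI'[OF assms, where ?h1.0 = "\<lambda>u v. D1 h u v + D1 j u v" and ?h2.0 = "\<lambda>u v. D2 h u v + D2 j u v"])
       (intro DERIV_add Ck_on_SucD[OF Suc.prems(1)] Ck_on_SucD[OF Suc.prems(2)] Suc.IH h j; assumption)+
qed

lemma Ck_on_mult:
  assumes "open S"
  shows "Ck_on k S h \<Longrightarrow> Ck_on k S j \<Longrightarrow> Ck_on k S (\<lambda>u v. h u v * j u v)"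
proof (induction k arbitrary: h j)
  case 0
  then show ?case
    using continuous_on_mult[of S "\<lambda>p. h (fst p) (snd p)" "\<lambda>p. j (fst p) (snd p)"] by (simp add: split_beta')
next
  case (Suc k)
  have h: "Ck_on k S h" "Ck_on k S (D1 h)" "Ck_on k S (D2 h)"
    and j: "Ck_on k S j" "Ck_on k S (D1 j)" "Ck_on k S (D2 j)"
    using Suc.prems Ck_on_Suc_imp[OF assms Suc.prems(1)] Ck_on_Suc_imp[OF assms Suc.prems(2)] by auto
  show ?case
    by (rule Ck_on_SucI'[OF assms, where ?h1.0 = "\<lambda>u v. D1 h u v * j u v + D1 j u v * h u v"
          and ?h2.0 = "\<lambda>u v. D2 h u v * j u v + D2 j u v * h u v"])
       (intro DERIV_mult Ck_on_SucD[OF Suc.prems(1)] Ck_on_SucD[OF Suc.prems(2)] Ck_on_add[OF assms]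
          Suc.IH h j; assumption)+
qed

lemma Ck_on_inverse:
  assumes "open S" "\<And>u v. (u, v) \<in> S \<Longrightarrow> h u v \<noteq> 0"
  shows "Ck_on k S h \<Longrightarrow> Ck_on k S (\<lambda>u v. inverse (h u v))"
proof (induction k)
  case 0
  then show ?case
    using assms(2) continuous_on_inverse[of S "\<lambda>p. h (fst p) (snd p)"] by (simp add: split_beta')
next
  case (Suc k)
  have h: "Ck_on k S (\<lambda>u v. inverse (h u v))" using Suc.IH Ck_on_Suc_imp[OF assms(1) Suc.prems] .
  show ?case
  proof (rule Ck_on_SucI'[OF assms(1), where ?h1.0 = "\<lambda>u v. (-1) * (inverse (h u v) * D1 h u v * inverse (h u v))"
          and ?h2.0 = "\<lambda>u v. (-1) * (inverse (h u v) * D2 h u v * inverse (h u v))"])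
    fix u v assume uv: "(u, v) \<in> S"
    show "((\<lambda>s. inverse (h s v)) has_real_derivative (-1) * (inverse (h u v) * D1 h u v * inverse (h u v))) (at u)"
      using DERIV_inverse'[OF Ck_on_SucD(1)[OF Suc.prems uv]] assms(2)[OF uv] by simp
    show "((\<lambda>s. inverse (h u s)) has_real_derivative (-1) * (inverse (h u v) * D2 h u v * inverse (h u v))) (at v)"
      using DERIV_inverse'[OF Ck_on_SucD(2)[OF Suc.prems uv]] assms(2)[OF uv] by simp
  qed (intro Ck_on_mult Ck_on_const assms(1) h; use Suc.prems in simp)+
qed

lemma Ck_on_compose:
  assumes "open S"
  shows "Ck_on k UNIV c \<Longrightarrow> Ck_on k S h \<Longrightarrow> Ck_on k S (\<lambda>u v. c u (h u v))"
proof (induction k arbitrary: c h)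
  case 0
  then have "continuous_on S (\<lambda>p. (fst p, h (fst p) (snd p)))"
    by (intro continuous_on_Pair continuous_on_fst continuous_on_id) (simp add: split_beta')
  from continuous_on_compose2[OF 0(1)[unfolded Ck_on.simps] this subset_UNIV]
  show ?case by (simp add: split_beta')
next
  case (Suc k)
  have h: "Ck_on k S h" using Ck_on_Suc_imp[OF assms Suc.prems(2)] .
  have c1: "Ck_on (Suc 0) UNIV c"
    using Suc.prems(1) Ck_on_continuous[OF open_UNIV Ck_on_Suc_D(1)[OF Suc.prems(1)]]
      Ck_on_continuous[OF open_UNIV Ck_on_Suc_D(2)[OF Suc.prems(1)]] by simp
  have d: "((\<lambda>(a, b). c a b) has_derivative (\<lambda>(a, b). D1 c u v * a + D2 c u v * b)) (at (u, v))" for u v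
    using C1_has_derivative[OF open_UNIV c1 UNIV_I] .
  show ?case
  proof (rule Ck_on_SucI'[OF assms, where ?h1.0 = "\<lambda>u v. D1 c u (h u v) + D2 c u (h u v) * D1 h u v"
          and ?h2.0 = "\<lambda>u v. D2 c u (h u v) * D2 h u v"])
    fix u v assume uv: "(u, v) \<in> S"
    have "((\<lambda>s. (s, h s v)) has_derivative (\<lambda>t. (t, D1 h u v * t))) (at u)"
      using Ck_on_SucD(1)[OF Suc.prems(2) uv] unfolding has_field_derivative_def
      by (auto intro!: derivative_eq_intros)
    from has_derivative_compose[OF this d, unfolded prod.case]
    show "((\<lambda>s. c s (h s v)) has_real_derivative D1 c u (h u v) + D2 c u (h u v) * D1 h u v) (at u)"
      by (rule has_derivative_imp_has_field_derivative) (simp add: algebra_simps)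
    have "((\<lambda>s. (u, h u s)) has_derivative (\<lambda>t. (0, D2 h u v * t))) (at v)"
      using Ck_on_SucD(2)[OF Suc.prems(2) uv] unfolding has_field_derivative_def
      by (auto intro!: derivative_eq_intros)
    from has_derivative_compose[OF this d, unfolded prod.case]
    show "((\<lambda>s. c u (h u s)) has_real_derivative D2 c u (h u v) * D2 h u v) (at v)"
      by (rule has_derivative_imp_has_field_derivative) (simp add: algebra_simps)
  next
    show "Ck_on k S (\<lambda>u v. D1 c u (h u v) + D2 c u (h u v) * D1 h u v)"
      by (intro Ck_on_add Ck_on_mult assms Suc.IH[of "D1 c" h] Suc.IH[of "D2 c" h] h Ck_on_Suc_D[OF Suc.prems(1)]
          Ck_on_Suc_D[OF Suc.prems(2)])
    show "Ck_on k S (\<lambda>u v. D2 c u (h u v) * D2 h u v)"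
      by (intro Ck_on_mult assms Suc.IH[of "D2 c" h] h Ck_on_Suc_D[OF Suc.prems(1)] Ck_on_Suc_D[OF Suc.prems(2)])
  qed
qed

lemma mixed_difference:
  assumes "open S" "Ck_on (Suc (Suc 0)) S h" "{u..u + r} \<times> {v..v + r} \<subseteq> S" "r > 0"
  obtains a b where "a \<in> {u..u + r}" "b \<in> {v..v + r}"
    "h (u + r) (v + r) - h (u + r) v - (h u (v + r) - h u v) = r * r * D2 (D1 h) a b"
proof -
  have "\<exists>a>u. a < u + r \<and> (h (u + r) (v + r) - h (u + r) v) - (h u (v + r) - h u v)
      = (u + r - u) * (D1 h a (v + r) - D1 h a v)"
  proof (rule MVT2)
    fix x assume "u \<le> x" "x \<le> u + r"
    then have "(x, v + r) \<in> S" "(x, v) \<in> S" using assms(3,4) by auto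
    then show "((\<lambda>x. h x (v + r) - h x v) has_real_derivative D1 h x (v + r) - D1 h x v) (at x)"
      using Ck_on_SucD(1)[OF assms(2)] by (auto intro: DERIV_diff)
  qed (use assms(4) in auto)
  then obtain a where a: "a > u" "a < u + r"
    "(h (u + r) (v + r) - h (u + r) v) - (h u (v + r) - h u v) = r * (D1 h a (v + r) - D1 h a v)"
    by auto
  have "\<exists>b>v. b < v + r \<and> D1 h a (v + r) - D1 h a v = (v + r - v) * D2 (D1 h) a b"
  proof (rule MVT2)
    fix y assume "v \<le> y" "y \<le> v + r"
    then have "(a, y) \<in> S" using a assms(3) by auto
    moreover have "Ck_on (Suc 0) S (D1 h)" using assms(2) by auto
    ultimately show "((\<lambda>y. D1 h a y) has_real_derivative D2 (D1 h) a y) (at y)"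
      using Ck_on_SucD(2) by blast
  qed (use assms(4) in auto)
  then obtain b where "b > v" "b < v + r" "D1 h a (v + r) - D1 h a v = r * D2 (D1 h) a b" by auto
  then show ?thesis using that[of a b] a by auto
qed

lemma Ck_on_swap: "Ck_on k S h \<Longrightarrow> Ck_on k (prod.swap ` S) (\<lambda>u v. h v u)"
proof (induction k arbitrary: h)
  case 0
  have "continuous_on (prod.swap ` S) (\<lambda>p. (\<lambda>(u, v). h u v) (prod.swap p))"
    by (rule continuous_on_compose2[OF 0[unfolded Ck_on.simps] continuous_on_swap]) auto
  then show ?case by (simp add: split_beta')
next
  case (Suc k)
  have "D1 (\<lambda>u v. h v u) = (\<lambda>u v. D2 h v u)" "D2 (\<lambda>u v. h v u) = (\<lambda>u v. D1 h v u)"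
    by (auto simp: D1_def D2_def fun_eq_iff)
  then show ?case using Suc by auto
qed

lemma D1_D2_commute:
  assumes "open S" "Ck_on (Suc (Suc 0)) S h" "(u, v) \<in> S"
  shows "D1 (D2 h) u v = D2 (D1 h) u v"
proof -
  have c: "continuous (at (u, v)) (\<lambda>(u, v). D1 (D2 h) u v)" "continuous (at (u, v)) (\<lambda>(u, v). D2 (D1 h) u v)"
    using assms by (auto simp: continuous_on_eq_continuous_at)
  have "\<bar>D1 (D2 h) u v - D2 (D1 h) u v\<bar> < e" if "e > 0" for e
  proof -
    have "\<forall>\<^sub>F p in nhds (u, v). dist ((\<lambda>(u, v). D1 (D2 h) u v) p) (D1 (D2 h) u v) < e/2 \<and>
        dist ((\<lambda>(u, v). D2 (D1 h) u v) p) (D2 (D1 h) u v) < e/2 \<and> p \<in> S"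
      using tendstoD[OF c(1)[unfolded isCont_def tendsto_at_iff_tendsto_nhds], of "e/2"]
        tendstoD[OF c(2)[unfolded isCont_def tendsto_at_iff_tendsto_nhds], of "e/2"] \<open>e > 0\<close>
      by (intro eventually_conj eventually_nhds_in_open assms(1,3)) simp_all
    then obtain d where d: "d > 0" "\<And>p. dist p (u, v) < d \<Longrightarrow> dist ((\<lambda>(u, v). D1 (D2 h) u v) p) (D1 (D2 h) u v) < e/2 \<and>
        dist ((\<lambda>(u, v). D2 (D1 h) u v) p) (D2 (D1 h) u v) < e/2 \<and> p \<in> S"
      unfolding eventually_nhds_metric by blast
    define r where "r = d / 3"
    have near: "dist (a, b) (u, v) < d" if "a \<in> {u..u + r}" "b \<in> {v..v + r}" for a b
    proof -
      have "dist (a, b) (u, v) \<le> \<bar>a - u\<bar> + \<bar>b - v\<bar>"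
        unfolding dist_prod_def dist_real_def by (simp add: sqrt_sum_squares_le_sum_abs)
      then show ?thesis using that d(1) by (auto simp: r_def)
    qed
    have "r > 0" using d(1) by (simp add: r_def)
    have sub: "{u..u + r} \<times> {v..v + r} \<subseteq> S" using near d(2) by blast
    obtain a b where ab: "a \<in> {u..u + r}" "b \<in> {v..v + r}"
      "h (u + r) (v + r) - h (u + r) v - (h u (v + r) - h u v) = r * r * D2 (D1 h) a b"
      using mixed_difference[OF assms(1,2) sub \<open>r > 0\<close>] .
    have "prod.swap ` S = prod.swap -` S" by force
    then have sw: "open (prod.swap ` S)" "{v..v + r} \<times> {u..u + r} \<subseteq> prod.swap ` S"
      using sub open_vimage[OF assms(1) continuous_on_swap] by auto
    have D: "D2 (D1 (\<lambda>u v. h v u)) = (\<lambda>u v. D1 (D2 h) v u)"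
      by (auto simp: D1_def D2_def fun_eq_iff)
    obtain b' a' where ab': "b' \<in> {v..v + r}" "a' \<in> {u..u + r}"
      "h (u + r) (v + r) - h u (v + r) - (h (u + r) v - h u v) = r * r * D1 (D2 h) a' b'"
      using mixed_difference[OF sw(1) Ck_on_swap[OF assms(2)] sw(2) \<open>r > 0\<close>] unfolding D .
    have "r * r * D2 (D1 h) a b = r * r * D1 (D2 h) a' b'" using ab(3) ab'(3) by linarith
    then have "D2 (D1 h) a b = D1 (D2 h) a' b'" using \<open>r > 0\<close> by simp
    moreover have "\<bar>D2 (D1 h) a b - D2 (D1 h) u v\<bar> < e/2" "\<bar>D1 (D2 h) a' b' - D1 (D2 h) u v\<bar> < e/2"
      using d(2)[OF near[OF ab(1,2)]] d(2)[OF near[OF ab'(2,1)]] by (auto simp: dist_real_def)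
    ultimately show ?thesis by linarith
  qed
  from this[of "\<bar>D1 (D2 h) u v - D2 (D1 h) u v\<bar>"] show ?thesis by force
qed

section \<open>Derivatives bounded as the parameter tends to zero\<close>

lemma smooth2_on_D:
  assumes "smooth2_on S h" shows "smooth2_on S (D1 h)" and "smooth2_on S (D2 h)"
proof -
  have "Ck_on (Suc k) S h" for k using assms by (simp only: smooth2_on_def)
  from Ck_on_Suc_D[OF this] show "smooth2_on S (D1 h)" and "smooth2_on S (D2 h)"
    by (simp_all add: smooth2_on_def)
qed

lemma smooth2_on_DERIV:
  assumes "smooth2_on S h" "(u, v) \<in> S"
  shows "((\<lambda>s. h s v) has_real_derivative D1 h u v) (at u)"
    and "((\<lambda>s. h u s) has_real_derivative D2 h u v) (at v)"
proof -
  have "Ck_on (Suc 0) S h" using assms(1) by (simp only: smooth2_on_def)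
  from Ck_on_SucD[OF this assms(2)]
  show "((\<lambda>s. h s v) has_real_derivative D1 h u v) (at u)"
    and "((\<lambda>s. h u s) has_real_derivative D2 h u v) (at v)" .
qed

lemma smooth2_on_has_derivative:
  assumes "open S" "smooth2_on S h" "(u, v) \<in> S"
  shows "((\<lambda>(a, b). h a b) has_derivative (\<lambda>(a, b). D1 h u v * a + D2 h u v * b)) (at (u, v))"
  by (rule C1_has_derivative[OF assms(1) _ assms(3)]) (use assms(2) in \<open>simp only: smooth2_on_def\<close>)

lemma smooth2_on_cong:
  "open S \<Longrightarrow> smooth2_on S h \<Longrightarrow> (\<And>u v. (u, v) \<in> S \<Longrightarrow> h u v = j u v) \<Longrightarrow> smooth2_on S j"
  unfolding smooth2_on_def by (intro allI, rule Ck_on_cong[where h=h]) auto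

lemma smooth2_on_subset: "smooth2_on S h \<Longrightarrow> T \<subseteq> S \<Longrightarrow> smooth2_on T h"
  unfolding smooth2_on_def by (intro allI, rule Ck_on_subset) auto

lemma smooth2_on_const: "open S \<Longrightarrow> smooth2_on S (\<lambda>u v. c)"
  unfolding smooth2_on_def by (intro allI Ck_on_const) auto

lemma smooth2_on_proj:
  assumes "open S" shows "smooth2_on S (\<lambda>u v. u)" and "smooth2_on S (\<lambda>u v. v)"
  by (simp_all add: smooth2_on_def Ck_on_proj[OF assms])

lemma smooth2_on_add:
  "open S \<Longrightarrow> smooth2_on S h \<Longrightarrow> smooth2_on S j \<Longrightarrow> smooth2_on S (\<lambda>u v. h u v + j u v)"
  unfolding smooth2_on_def by (intro allI Ck_on_add) auto

lemma smooth2_on_mult: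
  "open S \<Longrightarrow> smooth2_on S h \<Longrightarrow> smooth2_on S j \<Longrightarrow> smooth2_on S (\<lambda>u v. h u v * j u v)"
  unfolding smooth2_on_def by (intro allI Ck_on_mult) auto

lemma smooth2_on_diff:
  assumes "open S" "smooth2_on S h" "smooth2_on S j"
  shows "smooth2_on S (\<lambda>u v. h u v - j u v)"
  using smooth2_on_add[OF assms(1,2) smooth2_on_mult[OF assms(1) smooth2_on_const[OF assms(1), of "-1"] assms(3)]]
  by simp

lemma smooth2_on_inverse:
  "open S \<Longrightarrow> (\<And>u v. (u, v) \<in> S \<Longrightarrow> h u v \<noteq> 0) \<Longrightarrow> smooth2_on S h \<Longrightarrow> smooth2_on S (\<lambda>u v. inverse (h u v))"
  unfolding smooth2_on_def by (intro allI, rule Ck_on_inverse) auto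

lemma smooth2_on_compose:
  "open S \<Longrightarrow> smooth2_on UNIV c \<Longrightarrow> smooth2_on S h \<Longrightarrow> smooth2_on S (\<lambda>u v. c u (h u v))"
  unfolding smooth2_on_def by (intro allI, rule Ck_on_compose[where c = c and h = h]) auto

lemma smooth2_on_pow:
  assumes "smooth2_on S h" shows "smooth2_on S ((D1 ^^ k) h)" and "smooth2_on S ((D2 ^^ k) h)"
  using assms by (induction k) (simp_all add: smooth2_on_D)

lemma smooth2_on_commute:
  assumes "open S" "smooth2_on S h" "(u, v) \<in> S"
  shows "D1 (D2 h) u v = D2 (D1 h) u v"
  by (rule D1_D2_commute[OF assms(1) _ assms(3)]) (use assms(2) in \<open>simp only: smooth2_on_def\<close>)

lemma D_pow_cong:
  assumes "open S" "\<And>a b. (a, b) \<in> S \<Longrightarrow> h a b = k a b"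
  shows "(u, v) \<in> S \<Longrightarrow> (D2 ^^ n) h u v = (D2 ^^ n) k u v"
proof (induction n arbitrary: u v)
  case 0
  then show ?case using assms(2)[OF 0] by simp
next
  case (Suc n)
  have "D2 ((D2 ^^ n) h) u v = D2 ((D2 ^^ n) k) u v"
    by (rule D_cong(2)[OF assms(1) Suc.prems]) (rule Suc.IH)
  then show ?case by simp
qed

lemma D2_D1_pow:
  assumes "open S" "smooth2_on S h"
  shows "(u, v) \<in> S \<Longrightarrow> D2 ((D1 ^^ k) h) u v = (D1 ^^ k) (D2 h) u v"
proof (induction k arbitrary: u v)
  case (Suc k)
  have "D2 (D1 ((D1 ^^ k) h)) u v = D1 (D2 ((D1 ^^ k) h)) u v"
    by (rule smooth2_on_commute[OF assms(1) smooth2_on_pow(1)[OF assms(2)] Suc.prems, symmetric])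
  also have "\<dots> = D1 ((D1 ^^ k) (D2 h)) u v"
    by (rule D_cong(1)[OF assms(1) Suc.prems]) (rule Suc.IH)
  finally show ?case by simp
qed simp

lemma D1_D2_pow:
  assumes "open S" "smooth2_on S h"
  shows "(u, v) \<in> S \<Longrightarrow> D1 ((D2 ^^ k) h) u v = (D2 ^^ k) (D1 h) u v"
proof (induction k arbitrary: u v)
  case (Suc k)
  have "D1 (D2 ((D2 ^^ k) h)) u v = D2 (D1 ((D2 ^^ k) h)) u v"
    by (rule smooth2_on_commute[OF assms(1) smooth2_on_pow(2)[OF assms(2)] Suc.prems])
  also have "\<dots> = D2 ((D2 ^^ k) (D1 h)) u v"
    by (rule D_cong(2)[OF assms(1) Suc.prems]) (rule Suc.IH)
  finally show ?case by simp
qed simp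

lemma D_add:
  assumes "smooth2_on S h" "smooth2_on S j" "(u, v) \<in> S"
  shows "D1 (\<lambda>u v. h u v + j u v) u v = D1 h u v + D1 j u v"
    and "D2 (\<lambda>u v. h u v + j u v) u v = D2 h u v + D2 j u v"
  using DERIV_imp_deriv[OF DERIV_add[OF smooth2_on_DERIV(1)[OF assms(1,3)] smooth2_on_DERIV(1)[OF assms(2,3)]]]
    DERIV_imp_deriv[OF DERIV_add[OF smooth2_on_DERIV(2)[OF assms(1,3)] smooth2_on_DERIV(2)[OF assms(2,3)]]]
  unfolding D1_def D2_def .

lemma D_diff:
  assumes "smooth2_on S h" "smooth2_on S j" "(u, v) \<in> S"
  shows "D1 (\<lambda>u v. h u v - j u v) u v = D1 h u v - D1 j u v"
    and "D2 (\<lambda>u v. h u v - j u v) u v = D2 h u v - D2 j u v"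
  using DERIV_imp_deriv[OF DERIV_diff[OF smooth2_on_DERIV(1)[OF assms(1,3)] smooth2_on_DERIV(1)[OF assms(2,3)]]]
    DERIV_imp_deriv[OF DERIV_diff[OF smooth2_on_DERIV(2)[OF assms(1,3)] smooth2_on_DERIV(2)[OF assms(2,3)]]]
  unfolding D1_def D2_def .

lemma D_mult:
  assumes "smooth2_on S h" "smooth2_on S j" "(u, v) \<in> S"
  shows "D1 (\<lambda>u v. h u v * j u v) u v = D1 h u v * j u v + D1 j u v * h u v"
    and "D2 (\<lambda>u v. h u v * j u v) u v = D2 h u v * j u v + D2 j u v * h u v"
  using DERIV_imp_deriv[OF DERIV_mult[OF smooth2_on_DERIV(1)[OF assms(1,3)] smooth2_on_DERIV(1)[OF assms(2,3)]]]
    DERIV_imp_deriv[OF DERIV_mult[OF smooth2_on_DERIV(2)[OF assms(1,3)] smooth2_on_DERIV(2)[OF assms(2,3)]]]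
  unfolding D1_def D2_def .

lemma DERIV_compose2:
  assumes "smooth2_on UNIV c" "(p has_real_derivative p') (at s)" "(q has_real_derivative q') (at s)"
  shows "((\<lambda>t. c (p t) (q t)) has_real_derivative D1 c (p s) (q s) * p' + D2 c (p s) (q s) * q') (at s)"
proof -
  have "((\<lambda>t. (p t, q t)) has_derivative (\<lambda>t. (p' * t, q' * t))) (at s)"
    using assms(2,3) unfolding has_field_derivative_def by (intro has_derivative_Pair)
  from has_derivative_compose[OF this smooth2_on_has_derivative[OF open_UNIV assms(1) UNIV_I], unfolded prod.case]
  show ?thesis
    by (rule has_derivative_imp_has_field_derivative) (simp add: algebra_simps)
qed

lemma D_compose:
  assumes "smooth2_on UNIV c" "smooth2_on S h" "(u, v) \<in> S"
  shows "D1 (\<lambda>u v. c u (h u v)) u v = D1 c u (h u v) + D2 c u (h u v) * D1 h u v"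
    and "D2 (\<lambda>u v. c u (h u v)) u v = D2 c u (h u v) * D2 h u v"
  using DERIV_imp_deriv[OF DERIV_compose2[OF assms(1) DERIV_ident smooth2_on_DERIV(1)[OF assms(2,3)]]]
    DERIV_imp_deriv[OF DERIV_compose2[OF assms(1) DERIV_const smooth2_on_DERIV(2)[OF assms(2,3)]]]
  unfolding D1_def D2_def by simp_all

lemma tendsto_compose2:
  assumes "smooth2_on UNIV c" "(p \<longlongrightarrow> y) F"
  shows "((\<lambda>e. c x (p e)) \<longlongrightarrow> c x y) F"
proof -
  have "isCont (\<lambda>s. c x s) y"
    using smooth2_on_DERIV(2)[OF assms(1)] DERIV_isCont by blast
  then show ?thesis using isCont_tendsto_compose assms(2) by blast
qed

primrec bounded_jet :: "nat \<Rightarrow> real \<Rightarrow> (real \<Rightarrow> real \<Rightarrow> real) \<Rightarrow> bool" where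
  "bounded_jet 0 x h \<longleftrightarrow> h x \<in> O[at_right 0](\<lambda>_. 1)"
| "bounded_jet (Suc m) x h \<longleftrightarrow>
     h x \<in> O[at_right 0](\<lambda>_. 1) \<and> bounded_jet m x (D1 h) \<and> bounded_jet m x (D2 h)"

lemma bounded_jet_0: "bounded_jet m x h \<Longrightarrow> h x \<in> O[at_right 0](\<lambda>_. 1)"
  by (cases m) auto

lemma bounded_jet_Suc: "bounded_jet (Suc m) x h \<Longrightarrow> bounded_jet m x h"
proof (induction m arbitrary: h)
  case (Suc m)
  have "bounded_jet m x (D1 h)" "bounded_jet m x (D2 h)"
    by (rule Suc.IH; use Suc.prems in simp)+
  then show ?case using bounded_jet_0[OF Suc.prems] by simp
qed simp

locale limit_domain =
  fixes S :: "(real \<times> real) set" and x :: real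
  assumes open_S: "open S" and in_S: "\<forall>\<^sub>F e in at_right 0. (x, e) \<in> S"
begin

lemma bounded_jet_cong:
  "bounded_jet m x h \<Longrightarrow> (\<And>u v. (u, v) \<in> S \<Longrightarrow> h u v = j u v) \<Longrightarrow> bounded_jet m x j"
proof (induction m arbitrary: h j)
  case 0
  have "\<forall>\<^sub>F e in at_right 0. h x e = j x e"
    using in_S by eventually_elim (rule 0(2))
  then show ?case using 0(1) landau_o.big.in_cong[of "h x" "j x"] by simp
next
  case (Suc m)
  have "\<forall>\<^sub>F e in at_right 0. h x e = j x e"
    using in_S by eventually_elim (rule Suc.prems(2))
  then have "j x \<in> O[at_right 0](\<lambda>_. 1)"
    using Suc.prems(1) landau_o.big.in_cong[of "h x" "j x"] by simp
  moreover have "bounded_jet m x (D1 j)"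
    by (rule Suc.IH[of "D1 h"]) (use Suc.prems(1) in simp, rule D_cong(1)[OF open_S _ Suc.prems(2)])
  moreover have "bounded_jet m x (D2 j)"
    by (rule Suc.IH[of "D2 h"]) (use Suc.prems(1) in simp, rule D_cong(2)[OF open_S _ Suc.prems(2)])
  ultimately show ?case by simp
qed

lemma bounded_jet_const: "bounded_jet m x (\<lambda>u v. c)"
proof (induction m arbitrary: c)
  case (Suc m)
  moreover have "D1 (\<lambda>u v. c) = (\<lambda>u v. 0)" "D2 (\<lambda>u v. c) = (\<lambda>u v. 0)"
    by (simp_all add: D1_def D2_def fun_eq_iff)
  ultimately show ?case by simp
qed simp

lemma bounded_jet_add:
  "smooth2_on S h \<Longrightarrow> smooth2_on S j \<Longrightarrow> bounded_jet m x h \<Longrightarrow> bounded_jet m x j \<Longrightarrow>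
    bounded_jet m x (\<lambda>u v. h u v + j u v)"
proof (induction m arbitrary: h j)
  case 0
  then show ?case by (auto intro: sum_in_bigo)
next
  case (Suc m)
  have "bounded_jet m x (\<lambda>u v. D1 h u v + D1 j u v)" "bounded_jet m x (\<lambda>u v. D2 h u v + D2 j u v)"
    using Suc.prems(3,4) by (intro Suc.IH smooth2_on_D Suc.prems; simp)+
  from bounded_jet_cong[OF this(1)] bounded_jet_cong[OF this(2)]
  have "bounded_jet m x (D1 (\<lambda>u v. h u v + j u v))" "bounded_jet m x (D2 (\<lambda>u v. h u v + j u v))"
    by (simp_all add: D_add[OF Suc.prems(1,2)])
  then show ?case using Suc.prems by (auto intro: sum_in_bigo)
qed

lemma bounded_jet_mult:
  "smooth2_on S h \<Longrightarrow> smooth2_on S j \<Longrightarrow> bounded_jet m x h \<Longrightarrow> bounded_jet m x j \<Longrightarrow>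
    bounded_jet m x (\<lambda>u v. h u v * j u v)"
proof (induction m arbitrary: h j)
  case 0
  then show ?case by (auto intro: landau_o.big.mult_in_1)
next
  case (Suc m)
  note hj = bounded_jet_Suc[OF Suc.prems(3)] bounded_jet_Suc[OF Suc.prems(4)]
  have "bounded_jet m x (\<lambda>u v. D1 h u v * j u v + D1 j u v * h u v)"
    "bounded_jet m x (\<lambda>u v. D2 h u v * j u v + D2 j u v * h u v)"
    using Suc.prems(3,4) hj
    by (intro bounded_jet_add smooth2_on_mult[OF open_S] Suc.IH smooth2_on_D Suc.prems; simp)+
  from bounded_jet_cong[OF this(1)] bounded_jet_cong[OF this(2)]
  have "bounded_jet m x (D1 (\<lambda>u v. h u v * j u v))" "bounded_jet m x (D2 (\<lambda>u v. h u v * j u v))"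
    by (simp_all add: D_mult[OF Suc.prems(1,2)])
  then show ?case using Suc.prems by (auto intro: landau_o.big.mult_in_1)
qed

text \<open>Only the behaviour as \<open>e\<close> tends to \<open>0\<close> at the single abscissa \<open>x\<close> is controlled.\<close>

definition tame :: "(real \<Rightarrow> real \<Rightarrow> real) \<Rightarrow> bool" where
  "tame h \<longleftrightarrow> smooth2_on S h \<and> (\<forall>m. bounded_jet m x h)"

lemma tame_smooth: "tame h \<Longrightarrow> smooth2_on S h"
  by (simp add: tame_def)

lemma tame_bounded: "tame h \<Longrightarrow> h x \<in> O[at_right 0](\<lambda>_. 1)"
  unfolding tame_def using bounded_jet_0 by blast

lemma tame_cong: "tame h \<Longrightarrow> (\<And>u v. (u, v) \<in> S \<Longrightarrow> h u v = j u v) \<Longrightarrow> tame j"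
  unfolding tame_def using bounded_jet_cong smooth2_on_cong[OF open_S] by blast

lemma tame_const: "tame (\<lambda>u v. c)"
  unfolding tame_def using smooth2_on_const[OF open_S] bounded_jet_const by blast

lemma tame_add: "tame h \<Longrightarrow> tame j \<Longrightarrow> tame (\<lambda>u v. h u v + j u v)"
  unfolding tame_def using smooth2_on_add[OF open_S] bounded_jet_add by blast

lemma tame_mult: "tame h \<Longrightarrow> tame j \<Longrightarrow> tame (\<lambda>u v. h u v * j u v)"
  unfolding tame_def using smooth2_on_mult[OF open_S] bounded_jet_mult by blast

lemma tame_diff: "tame h \<Longrightarrow> tame j \<Longrightarrow> tame (\<lambda>u v. h u v - j u v)"
  using tame_add[OF _ tame_mult[OF tame_const[of "-1"]], of h j] by simp

lemma tame_D:
  assumes "tame h" shows "tame (D1 h)" and "tame (D2 h)"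
proof -
  have "bounded_jet m x (D1 h) \<and> bounded_jet m x (D2 h)" for m
    using assms bounded_jet.simps(2)[of m x h] unfolding tame_def by blast
  then show "tame (D1 h)" and "tame (D2 h)"
    using assms smooth2_on_D unfolding tame_def by blast+
qed

lemma tame_parameter: "tame (\<lambda>u v. v)"
proof -
  have "(\<lambda>v::real. v) \<in> O[at_right 0](\<lambda>_. 1)"
    by (rule bigoI_tendsto[of _ _ 0]) (auto intro: tendsto_eq_intros)
  moreover have "D1 (\<lambda>u v. v) = (\<lambda>u v. 0)" "D2 (\<lambda>u v. v) = (\<lambda>u v. 1)"
    by (simp_all add: D1_def D2_def fun_eq_iff)
  ultimately have "bounded_jet m x (\<lambda>u v. v)" for m
    using bounded_jet_const by (cases m) auto
  then show ?thesis unfolding tame_def using smooth2_on_proj[OF open_S] by blast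
qed

lemma tame_compose:
  assumes h: "tame h" "(h x \<longlongrightarrow> y) (at_right 0)" and "smooth2_on UNIV c"
  shows "tame (\<lambda>u v. c u (h u v))"
proof -
  have b: "(\<lambda>v. c x (h x v)) \<in> O[at_right 0](\<lambda>_. 1)" if "smooth2_on UNIV c" for c
    using tendsto_compose2[OF that h(2)] by (intro bigoI_tendsto[of _ _ "c x y"]) simp_all
  have "bounded_jet m x (\<lambda>u v. c u (h u v))" if "smooth2_on UNIV c" for m
    using that
  proof (induction m arbitrary: c)
    case 0
    then show ?case using b by simp
  next
    case (Suc m)
    note sm = smooth2_on_compose[OF open_S _ tame_smooth[OF h(1)]]
    have "bounded_jet m x (\<lambda>u v. D1 c u (h u v) + D2 c u (h u v) * D1 h u v)"
      "bounded_jet m x (\<lambda>u v. D2 c u (h u v) * D2 h u v)"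
      using Suc.IH[OF smooth2_on_D(1)[OF Suc.prems]] Suc.IH[OF smooth2_on_D(2)[OF Suc.prems]]
        sm[OF smooth2_on_D(1)[OF Suc.prems]] sm[OF smooth2_on_D(2)[OF Suc.prems]] tame_D[OF h(1)]
      unfolding tame_def by (auto intro!: bounded_jet_add bounded_jet_mult smooth2_on_mult[OF open_S])
    from bounded_jet_cong[OF this(1)] bounded_jet_cong[OF this(2)]
    have "bounded_jet m x (D1 (\<lambda>u v. c u (h u v)))" "bounded_jet m x (D2 (\<lambda>u v. c u (h u v)))"
      by (simp_all add: D_compose[OF Suc.prems tame_smooth[OF h(1)]])
    then show ?case using b[OF Suc.prems] by simp
  qed
  then show ?thesis
    unfolding tame_def using smooth2_on_compose[OF open_S assms(3) tame_smooth[OF h(1)]] assms(3) by blast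
qed

text \<open>Differentiating \<open>h * q = p\<close> expresses \<open>h\<close> times a derivative of \<open>q\<close> through lower derivatives.\<close>

lemma tame_quotient:
  assumes h: "tame h" "(h x \<longlongrightarrow> l) (at_right 0)" "l \<noteq> 0"
    and p: "tame p" and q: "smooth2_on S q" and eq: "\<And>u v. (u, v) \<in> S \<Longrightarrow> h u v * q u v = p u v"
  shows "tame q"
proof -
  have inv: "(\<lambda>e. inverse (h x e)) \<in> O[at_right 0](\<lambda>_. 1)"
    using tendsto_inverse[OF h(2,3)] by (intro bigoI_tendsto[of _ _ "inverse l"]) simp_all
  have nz: "\<forall>\<^sub>F e in at_right 0. h x e \<noteq> 0"
    by (rule tendsto_imp_eventually_ne[OF h(2,3)])
  have b: "q x \<in> O[at_right 0](\<lambda>_. 1)"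
    if "p x \<in> O[at_right 0](\<lambda>_. 1)" "\<And>u v. (u, v) \<in> S \<Longrightarrow> h u v * q u v = p u v" for p q
  proof -
    have "\<forall>\<^sub>F e in at_right 0. inverse (h x e) * p x e = q x e"
      using nz in_S by eventually_elim (simp add: that(2)[symmetric])
    moreover have "(\<lambda>e. inverse (h x e) * p x e) \<in> O[at_right 0](\<lambda>_. 1)"
      using inv that(1) by (rule landau_o.big.mult_in_1)
    ultimately show ?thesis by (rule landau_o.big.in_cong[THEN iffD1])
  qed
  have "bounded_jet m x q"
    if "smooth2_on S p" "bounded_jet m x p" "smooth2_on S q" "\<And>u v. (u, v) \<in> S \<Longrightarrow> h u v * q u v = p u v" for m p q
    using that
  proof (induction m arbitrary: p q)
    case 0
    then show ?case using b[of p q] by simp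
  next
    case (Suc m)
    note p = Suc.prems(1) and q = Suc.prems(3) and eq = Suc.prems(4) and h' = tame_smooth[OF h(1)]
    have bq: "bounded_jet m x q"
      using Suc.IH[OF p bounded_jet_Suc[OF Suc.prems(2)] q eq] .
    have bp: "bounded_jet m x (D1 p)" "bounded_jet m x (D2 p)" using Suc.prems(2) by simp_all
    have step: "bounded_jet m x q'"
      if p': "smooth2_on S p'" "bounded_jet m x p'" and k: "tame k" and q': "smooth2_on S q'"
        and e: "\<And>u v. (u, v) \<in> S \<Longrightarrow> k u v * q u v + q' u v * h u v = p' u v" for p' k q'
    proof (rule Suc.IH)
      note k' = tame_mult[OF tame_const[of "-1"] k]
      have kq: "smooth2_on S (\<lambda>u v. -1 * k u v * q u v)"
        by (rule smooth2_on_mult[OF open_S tame_smooth[OF k'] q])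
      show "smooth2_on S (\<lambda>u v. p' u v + (-1 * k u v * q u v))"
        by (rule smooth2_on_add[OF open_S p'(1) kq])
      have "bounded_jet m x (\<lambda>u v. -1 * k u v * q u v)"
        by (rule bounded_jet_mult[OF tame_smooth[OF k'] q _ bq]) (use k' in \<open>simp only: tame_def\<close>)
      then show "bounded_jet m x (\<lambda>u v. p' u v + (-1 * k u v * q u v))"
        by (rule bounded_jet_add[OF p'(1) kq p'(2)])
      show "smooth2_on S q'" by fact
      show "h u v * q' u v = p' u v + (-1 * k u v * q u v)" if "(u, v) \<in> S" for u v
        using e[OF that] by (simp add: algebra_simps)
    qed
    have "bounded_jet m x (D1 q)" "bounded_jet m x (D2 q)"
      using D_mult[OF h' q] D_cong[OF open_S _ eq]
      by (intro step[OF _ bp(1) tame_D(1)[OF h(1)]] step[OF _ bp(2) tame_D(2)[OF h(1)]]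
            smooth2_on_D p q; simp)+
    then show ?case using b[OF _ eq] Suc.prems(2) by simp
  qed
  then show ?thesis using p q eq unfolding tame_def by blast
qed

end

section \<open>The functions \<open>phi\<close>\<close>

inductive parameter_poly :: "(real \<Rightarrow> real \<Rightarrow> real \<Rightarrow> real) \<Rightarrow> bool" where
  coeff: "smooth2_on UNIV c \<Longrightarrow> parameter_poly (\<lambda>x y e. c x y)"
| parameter: "parameter_poly (\<lambda>x y e. e)"
| add: "parameter_poly \<psi> \<Longrightarrow> parameter_poly \<theta> \<Longrightarrow> parameter_poly (\<lambda>x y e. \<psi> x y e + \<theta> x y e)"
| mult: "parameter_poly \<psi> \<Longrightarrow> parameter_poly \<theta> \<Longrightarrow> parameter_poly (\<lambda>x y e. \<psi> x y e * \<theta> x y e)"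

lemma parameter_poly_const: "parameter_poly (\<lambda>x y e. c)"
  by (rule parameter_poly.coeff) (rule smooth2_on_const[OF open_UNIV])

definition gradient3 ::
  "(real \<Rightarrow> real \<Rightarrow> real \<Rightarrow> real) \<Rightarrow> (real \<Rightarrow> real \<Rightarrow> real \<Rightarrow> real) \<Rightarrow>
   (real \<Rightarrow> real \<Rightarrow> real \<Rightarrow> real) \<Rightarrow> (real \<Rightarrow> real \<Rightarrow> real \<Rightarrow> real) \<Rightarrow> bool" where
  "gradient3 \<psi> px py pe \<longleftrightarrow> (\<forall>p q r p' q' r' s.
     (p has_real_derivative p') (at s) \<longrightarrow> (q has_real_derivative q') (at s) \<longrightarrow>
     (r has_real_derivative r') (at s) \<longrightarrow>
     ((\<lambda>t. \<psi> (p t) (q t) (r t)) has_real_derivative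
       px (p s) (q s) (r s) * p' + py (p s) (q s) (r s) * q' + pe (p s) (q s) (r s) * r') (at s))"

lemma gradient3D:
  assumes "gradient3 \<psi> px py pe" "(p has_real_derivative p') (at s)" "(q has_real_derivative q') (at s)"
    "(r has_real_derivative r') (at s)"
  shows "((\<lambda>t. \<psi> (p t) (q t) (r t)) has_real_derivative
       px (p s) (q s) (r s) * p' + py (p s) (q s) (r s) * q' + pe (p s) (q s) (r s) * r') (at s)"
  using assms unfolding gradient3_def by blast

lemma gradient3_eq:
  assumes "gradient3 \<psi> px py pe" shows "px = dx \<psi>" "py = dy \<psi>" "pe = de \<psi>"
proof -
  have "((\<lambda>t. \<psi> t y e) has_real_derivative px x y e) (at x)" for x y e
    using gradient3D[OF assms, where p = "\<lambda>t. t" and q = "\<lambda>t. y" and r = "\<lambda>t. e", OF DERIV_ident DERIV_const DERIV_const]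
    by simp
  from DERIV_imp_deriv[OF this] show "px = dx \<psi>" by (simp add: dx_def fun_eq_iff)
  have "((\<lambda>t. \<psi> x t e) has_real_derivative py x y e) (at y)" for x y e
    using gradient3D[OF assms, where p = "\<lambda>t. x" and q = "\<lambda>t. t" and r = "\<lambda>t. e", OF DERIV_const DERIV_ident DERIV_const]
    by simp
  from DERIV_imp_deriv[OF this] show "py = dy \<psi>" by (simp add: dy_def fun_eq_iff)
  have "((\<lambda>t. \<psi> x y t) has_real_derivative pe x y e) (at e)" for x y e
    using gradient3D[OF assms, where p = "\<lambda>t. x" and q = "\<lambda>t. y" and r = "\<lambda>t. t", OF DERIV_const DERIV_const DERIV_ident]
    by simp
  from DERIV_imp_deriv[OF this] show "pe = de \<psi>" by (simp add: de_def fun_eq_iff)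
qed

lemma parameter_poly_gradient_ex:
  "parameter_poly \<psi> \<Longrightarrow>
    \<exists>px py pe. parameter_poly px \<and> parameter_poly py \<and> parameter_poly pe \<and> gradient3 \<psi> px py pe"
proof (induction rule: parameter_poly.induct)
  case (coeff c)
  have "gradient3 (\<lambda>x y e. c x y) (\<lambda>x y e. D1 c x y) (\<lambda>x y e. D2 c x y) (\<lambda>x y e. 0)"
    unfolding gradient3_def using DERIV_compose2[OF coeff] by simp
  moreover have "parameter_poly (\<lambda>x y e. D1 c x y)" "parameter_poly (\<lambda>x y e. D2 c x y)"
    by (intro parameter_poly.coeff smooth2_on_D coeff)+
  ultimately show ?case using parameter_poly_const[of 0] by blast
next
  case parameter
  have "gradient3 (\<lambda>x y e. e) (\<lambda>x y e. 0) (\<lambda>x y e. 0) (\<lambda>x y e. 1)"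
    unfolding gradient3_def by simp
  then show ?case using parameter_poly_const by blast
next
  case (add \<psi> \<theta>)
  obtain px py pe qx qy qe where p: "parameter_poly px" "parameter_poly py" "parameter_poly pe" "gradient3 \<psi> px py pe"
    and q: "parameter_poly qx" "parameter_poly qy" "parameter_poly qe" "gradient3 \<theta> qx qy qe"
    using add.IH by blast
  have "gradient3 (\<lambda>x y e. \<psi> x y e + \<theta> x y e) (\<lambda>x y e. px x y e + qx x y e) (\<lambda>x y e. py x y e + qy x y e)
      (\<lambda>x y e. pe x y e + qe x y e)"
    unfolding gradient3_def
  proof (intro allI impI, goal_cases)
    case (1 p' q' r' a b c s)
    show ?case
      by (rule DERIV_cong[OF DERIV_add[OF gradient3D[OF p(4) 1] gradient3D[OF q(4) 1]]]) (simp add: algebra_simps)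
  qed
  then show ?case using p(1-3) q(1-3) parameter_poly.add by blast
next
  case (mult \<psi> \<theta>)
  obtain px py pe qx qy qe where p: "parameter_poly px" "parameter_poly py" "parameter_poly pe" "gradient3 \<psi> px py pe"
    and q: "parameter_poly qx" "parameter_poly qy" "parameter_poly qe" "gradient3 \<theta> qx qy qe"
    using mult.IH by blast
  have "gradient3 (\<lambda>x y e. \<psi> x y e * \<theta> x y e) (\<lambda>x y e. px x y e * \<theta> x y e + \<psi> x y e * qx x y e)
      (\<lambda>x y e. py x y e * \<theta> x y e + \<psi> x y e * qy x y e) (\<lambda>x y e. pe x y e * \<theta> x y e + \<psi> x y e * qe x y e)"
    unfolding gradient3_def
  proof (intro allI impI, goal_cases)
    case (1 p' q' r' a b c s)
    show ?case
      by (rule DERIV_cong[OF DERIV_mult[OF gradient3D[OF p(4) 1] gradient3D[OF q(4) 1]]]) (simp add: algebra_simps)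
  qed
  moreover have "parameter_poly (\<lambda>x y e. rx x y e * \<theta> x y e + \<psi> x y e * sx x y e)"
    if "parameter_poly rx" "parameter_poly sx" for rx sx
    by (intro parameter_poly.add parameter_poly.mult that mult.hyps)
  note this[OF p(1) q(1)] this[OF p(2) q(2)] this[OF p(3) q(3)]
  ultimately show ?case by (intro exI conjI)
qed

lemma parameter_poly_gradient:
  assumes "parameter_poly \<psi>"
  shows "gradient3 \<psi> (dx \<psi>) (dy \<psi>) (de \<psi>)"
    and "parameter_poly (dx \<psi>)" "parameter_poly (dy \<psi>)" "parameter_poly (de \<psi>)"
proof -
  obtain px py pe where p: "parameter_poly px" "parameter_poly py" "parameter_poly pe" "gradient3 \<psi> px py pe"
    using parameter_poly_gradient_ex[OF assms] by blast
  note e = gradient3_eq[OF p(4)]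
  show "gradient3 \<psi> (dx \<psi>) (dy \<psi>) (de \<psi>)"
    and "parameter_poly (dx \<psi>)" "parameter_poly (dy \<psi>)" "parameter_poly (de \<psi>)"
    using p unfolding e by simp_all
qed

lemma parameter_poly_DERIV:
  assumes "parameter_poly \<psi>"
  shows "((\<lambda>s. \<psi> s y e) has_real_derivative dx \<psi> x y e) (at x)"
    and "((\<lambda>s. \<psi> x s e) has_real_derivative dy \<psi> x y e) (at y)"
    and "((\<lambda>s. \<psi> x y s) has_real_derivative de \<psi> x y e) (at e)"
  using gradient3D[OF parameter_poly_gradient(1)[OF assms], where p = "\<lambda>t. t" and q = "\<lambda>t. y" and r = "\<lambda>t. e", OF DERIV_ident DERIV_const DERIV_const]
    gradient3D[OF parameter_poly_gradient(1)[OF assms], where p = "\<lambda>t. x" and q = "\<lambda>t. t" and r = "\<lambda>t. e", OF DERIV_const DERIV_ident DERIV_const]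
    gradient3D[OF parameter_poly_gradient(1)[OF assms], where p = "\<lambda>t. x" and q = "\<lambda>t. y" and r = "\<lambda>t. t", OF DERIV_const DERIV_const DERIV_ident]
  by simp_all

lemma parameter_poly_tendsto:
  assumes "(q \<longlongrightarrow> y) F" "(r \<longlongrightarrow> l) F"
  shows "parameter_poly \<psi> \<Longrightarrow> ((\<lambda>t. \<psi> x (q t) (r t)) \<longlongrightarrow> \<psi> x y l) F"
proof (induction rule: parameter_poly.induct)
  case (coeff c)
  then show ?case using tendsto_compose2 assms(1) by blast
qed (auto intro: tendsto_add tendsto_mult assms(2))

lemma (in limit_domain) tame_parameter_poly:
  assumes "tame h" "(h x \<longlongrightarrow> y) (at_right 0)"
  shows "parameter_poly \<psi> \<Longrightarrow> tame (\<lambda>u v. \<psi> u (h u v) v)"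
proof (induction rule: parameter_poly.induct)
  case (coeff c)
  show ?case by (rule tame_compose[OF assms coeff])
qed (intro tame_parameter tame_add tame_mult; assumption)+

text \<open>\<open>phi f g (Suc k)\<close> multiplied by \<open>e ^ (k + 2)\<close>, which removes the negative powers of \<open>e\<close>.\<close>

primrec scaled_phi ::
  "(real \<Rightarrow> real \<Rightarrow> real) \<Rightarrow> (real \<Rightarrow> real \<Rightarrow> real) \<Rightarrow> nat \<Rightarrow> real \<Rightarrow> real \<Rightarrow> real \<Rightarrow> real" where
  "scaled_phi f g 0 = (\<lambda>x y e. f x y * (f x y * D1 g x y + (-1) * (g x y * D1 f x y))
     + e * (f x y * (g x y * D2 g x y) + (-1) * (g x y * (g x y * D2 f x y))))"
| "scaled_phi f g (Suc k) = (\<lambda>x y e. f x y * dx (scaled_phi f g k) x y e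
     + e * (g x y * dy (scaled_phi f g k) x y e))"

context
  fixes f g :: "real \<Rightarrow> real \<Rightarrow> real"
  assumes f: "smooth2_on UNIV f" and g: "smooth2_on UNIV g"
begin

lemma parameter_poly_scaled_phi: "parameter_poly (scaled_phi f g k)"
proof (induction k)
  case 0
  show ?case
    unfolding scaled_phi.simps
    by (intro parameter_poly.add parameter_poly.mult parameter_poly.parameter parameter_poly_const
        parameter_poly.coeff[OF f] parameter_poly.coeff[OF g]
        parameter_poly.coeff[OF smooth2_on_D(1)[OF f]] parameter_poly.coeff[OF smooth2_on_D(2)[OF f]]
        parameter_poly.coeff[OF smooth2_on_D(1)[OF g]] parameter_poly.coeff[OF smooth2_on_D(2)[OF g]])
next
  case (Suc k)
  show ?case
    unfolding scaled_phi.simps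
    by (intro parameter_poly.add parameter_poly.mult parameter_poly.parameter
        parameter_poly.coeff[OF f] parameter_poly.coeff[OF g] parameter_poly_gradient Suc)
qed

lemma phi_1:
  assumes "e \<noteq> 0"
  shows "phi f g (Suc 0) x y e = f x y / e * (f x y / e * D1 g x y + g x y * D2 g x y)
    - g x y * (f x y / e * (D1 f x y / e) + g x y * (D2 f x y / e))"
proof -
  have "dx (\<lambda>x y e. f x y / e) x y e = D1 f x y / e" "dy (\<lambda>x y e. f x y / e) x y e = D2 f x y / e"
    using smooth2_on_DERIV[OF f, of x y] unfolding dx_def dy_def
    by (auto intro!: DERIV_imp_deriv DERIV_cdivide)
  moreover have "dx (\<lambda>x y e. g x y) x y e = D1 g x y" "dy (\<lambda>x y e. g x y) x y e = D2 g x y"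
    by (simp_all add: dx_def dy_def D1_def D2_def)
  ultimately show ?thesis
    by (simp add: phi_def det_2 transpose_def acceleration_def velocity_def time_deriv_def)
qed

lemma phi_eq_scaled_phi: "e \<noteq> 0 \<Longrightarrow> phi f g (Suc k) x y e = scaled_phi f g k x y e / e ^ (k + 2)"
proof (induction k arbitrary: x y)
  case 0
  then show ?case by (simp add: phi_1 field_simps power2_eq_square)
next
  case (Suc k)
  let ?P = "scaled_phi f g k"
  have "phi f g (Suc (Suc k)) x y e = f x y / e * dx (phi f g (Suc k)) x y e + g x y * dy (phi f g (Suc k)) x y e"
    by (simp add: phi_def time_deriv_def)
  moreover have "dx (phi f g (Suc k)) x y e = dx ?P x y e / e ^ (k + 2)"
    "dy (phi f g (Suc k)) x y e = dy ?P x y e / e ^ (k + 2)"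
    using DERIV_imp_deriv[OF DERIV_cdivide[OF parameter_poly_DERIV(1)[OF parameter_poly_scaled_phi[of k], of y e x],
            where c = "e ^ (k + 2)"]]
      DERIV_imp_deriv[OF DERIV_cdivide[OF parameter_poly_DERIV(2)[OF parameter_poly_scaled_phi[of k], of x e y],
            where c = "e ^ (k + 2)"]]
    by (simp_all add: dx_def[of "phi f g (Suc k)"] dy_def[of "phi f g (Suc k)"] Suc.IH[OF Suc.prems])
  ultimately show ?case using Suc.prems by (simp add: field_simps)
qed

lemma DERIV_phi:
  assumes "r s \<noteq> 0" "(p has_real_derivative p') (at s)" "(q has_real_derivative q') (at s)"
    "(r has_real_derivative r') (at s)"
  shows "((\<lambda>t. phi f g (Suc k) (p t) (q t) (r t)) has_real_derivative
       dx (phi f g (Suc k)) (p s) (q s) (r s) * p' + dy (phi f g (Suc k)) (p s) (q s) (r s) * q'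
       + de (phi f g (Suc k)) (p s) (q s) (r s) * r') (at s)"
proof -
  let ?P = "scaled_phi f g k" and ?\<phi> = "phi f g (Suc k)"
  define T where "T = (\<lambda>b::real. inverse (b ^ (k + 2)))"
  have "(\<lambda>b. b ^ (k + 2)) differentiable (at (r s))" by simp
  then obtain R where R: "(T has_real_derivative R) (at (r s))"
    using DERIV_inverse'[of "\<lambda>b. b ^ (k + 2)" _ "r s"] assms(1)
    unfolding T_def real_differentiable_def by auto
  have chain: "((\<lambda>t. ?\<phi> (p t) (q t) (b t)) has_real_derivative
       (dx ?P (p u) (q u) (b u) * p' + dy ?P (p u) (q u) (b u) * q' + de ?P (p u) (q u) (b u) * b') * T (b u)
       + (R * b') * ?P (p u) (q u) (b u)) (at u)"
    if b: "b u = r s" and pqb: "(p has_real_derivative p') (at u)" "(q has_real_derivative q') (at u)"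
    "(b has_real_derivative b') (at u)" for p q b :: "real \<Rightarrow> real" and p' q' b' u
  proof -
    have "(T has_real_derivative R) (at (b u))" using R b by simp
    from DERIV_mult[OF gradient3D[OF parameter_poly_gradient(1)[OF parameter_poly_scaled_phi] pqb]
        DERIV_chain2[OF this pqb(3)]]
    have "((\<lambda>t. ?P (p t) (q t) (b t) * T (b t)) has_real_derivative
       (dx ?P (p u) (q u) (b u) * p' + dy ?P (p u) (q u) (b u) * q' + de ?P (p u) (q u) (b u) * b') * T (b u)
       + (R * b') * ?P (p u) (q u) (b u)) (at u)" .
    moreover have "\<forall>\<^sub>F t in nhds u. ?P (p t) (q t) (b t) * T (b t) = ?\<phi> (p t) (q t) (b t)"
    proof -
      have "(b \<longlongrightarrow> b u) (nhds u)"
        using DERIV_isCont[OF pqb(3)] by (simp add: isCont_def tendsto_at_iff_tendsto_nhds)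
      then have "\<forall>\<^sub>F t in nhds u. b t \<noteq> 0"
        by (rule tendsto_imp_eventually_ne) (use b assms(1) in simp)
      then show ?thesis
        by eventually_elim (simp add: phi_eq_scaled_phi T_def divide_inverse)
    qed
    ultimately show ?thesis by (simp add: DERIV_cong_ev)
  qed
  let ?p = "p s" and ?q = "q s" and ?r = "r s"
  have "dx ?\<phi> ?p ?q ?r = dx ?P ?p ?q ?r * T ?r"
    using DERIV_imp_deriv[OF chain[where p = "\<lambda>t. t" and q = "\<lambda>t. ?q" and b = "\<lambda>t. ?r",
          OF refl DERIV_ident DERIV_const DERIV_const]]
    by (simp add: dx_def[of ?\<phi>])
  moreover have "dy ?\<phi> ?p ?q ?r = dy ?P ?p ?q ?r * T ?r"
    using DERIV_imp_deriv[OF chain[where p = "\<lambda>t. ?p" and q = "\<lambda>t. t" and b = "\<lambda>t. ?r",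
          OF refl DERIV_const DERIV_ident DERIV_const]]
    by (simp add: dy_def[of ?\<phi>])
  moreover have "de ?\<phi> ?p ?q ?r = de ?P ?p ?q ?r * T ?r + R * ?P ?p ?q ?r"
    using DERIV_imp_deriv[OF chain[where p = "\<lambda>t. ?p" and q = "\<lambda>t. ?q" and b = "\<lambda>t. t",
          OF _ DERIV_const DERIV_const DERIV_ident]]
    by (simp add: de_def[of ?\<phi>])
  ultimately show ?thesis
    by (intro DERIV_cong[OF chain[OF refl assms(2-4)]]) (simp add: algebra_simps)
qed

lemma dy_phi: "e \<noteq> 0 \<Longrightarrow> dy (phi f g (Suc k)) x y e = dy (scaled_phi f g k) x y e / e ^ (k + 2)"
  using DERIV_imp_deriv[OF DERIV_cdivide[OF parameter_poly_DERIV(2)[OF parameter_poly_scaled_phi[of k], of x e y],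
        where c = "e ^ (k + 2)"]]
  by (simp add: dy_def[of "phi f g (Suc k)"] phi_eq_scaled_phi)

primrec critical_factor :: "nat \<Rightarrow> real \<Rightarrow> real \<Rightarrow> real" where
  "critical_factor 0 = (\<lambda>x y. f x y * D1 g x y - g x y * D1 f x y)"
| "critical_factor (Suc k) = D1 (\<lambda>x y. f x y * critical_factor k x y)"

lemma smooth2_on_critical_factor: "smooth2_on UNIV (critical_factor k)"
proof (induction k)
  case 0
  show ?case
    unfolding critical_factor.simps
    by (intro smooth2_on_diff smooth2_on_mult smooth2_on_D open_UNIV f g)
next
  case (Suc k)
  show ?case
    unfolding critical_factor.simps by (intro smooth2_on_mult smooth2_on_D(1) open_UNIV f Suc)
qed

lemma scaled_phi_0: "scaled_phi f g k x y 0 = f x y * critical_factor k x y"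
proof (induction k arbitrary: x y)
  case (Suc k)
  then show ?case by (simp add: dx_def D1_def)
qed simp

lemma dy_scaled_phi_0:
  assumes "f x y = 0"
  shows "dy (scaled_phi f g k) x y 0 = - (D2 f x y * g x y * D1 f x y ^ Suc k)"
proof -
  have "dy (scaled_phi f g k) x y 0 = D2 (\<lambda>x y. f x y * critical_factor k x y) x y"
    by (simp add: dy_def D2_def scaled_phi_0)
  also have "\<dots> = D2 f x y * critical_factor k x y"
    using D_mult(2)[OF f smooth2_on_critical_factor UNIV_I] assms by simp
  also have "critical_factor k x y = - (g x y * D1 f x y ^ Suc k)"
  proof (induction k)
    case (Suc k)
    have "critical_factor (Suc k) x y = D1 f x y * critical_factor k x y"
      using D_mult(1)[OF f smooth2_on_critical_factor[of k] UNIV_I, of x y] assms by simp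
    then show ?case using Suc.IH by simp
  qed (use assms in simp)
  finally show ?thesis by simp
qed

lemma gradient_scaled_phi_equilibrium:
  assumes eq: "f x y = 0" "g x y = 0"
  shows "dx (scaled_phi f g k) x y e = 0 \<and> dy (scaled_phi f g k) x y e = 0"
proof -
  define flat where "flat \<psi> \<longleftrightarrow>
    parameter_poly \<psi> \<and> \<psi> x y e = 0 \<and> dx \<psi> x y e = 0 \<and> dy \<psi> x y e = 0" for \<psi>
  have dmult: "dx (\<lambda>x y e. \<psi> x y e * \<theta> x y e) x y e = dx \<psi> x y e * \<theta> x y e + dx \<theta> x y e * \<psi> x y e"
    "dy (\<lambda>x y e. \<psi> x y e * \<theta> x y e) x y e = dy \<psi> x y e * \<theta> x y e + dy \<theta> x y e * \<psi> x y e"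
    if "parameter_poly \<psi>" "parameter_poly \<theta>" for \<psi> \<theta>
    using DERIV_imp_deriv[OF DERIV_mult[OF parameter_poly_DERIV(1)[OF that(1), of y e x] parameter_poly_DERIV(1)[OF that(2), of y e x]]]
      DERIV_imp_deriv[OF DERIV_mult[OF parameter_poly_DERIV(2)[OF that(1), of x e y] parameter_poly_DERIV(2)[OF that(2), of x e y]]]
    by (simp_all add: dx_def dy_def)
  have dadd: "dx (\<lambda>x y e. \<psi> x y e + \<theta> x y e) x y e = dx \<psi> x y e + dx \<theta> x y e"
    "dy (\<lambda>x y e. \<psi> x y e + \<theta> x y e) x y e = dy \<psi> x y e + dy \<theta> x y e"
    if "parameter_poly \<psi>" "parameter_poly \<theta>" for \<psi> \<theta>
    using DERIV_imp_deriv[OF DERIV_add[OF parameter_poly_DERIV(1)[OF that(1), of y e x] parameter_poly_DERIV(1)[OF that(2), of y e x]]]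
      DERIV_imp_deriv[OF DERIV_add[OF parameter_poly_DERIV(2)[OF that(1), of x e y] parameter_poly_DERIV(2)[OF that(2), of x e y]]]
    by (simp_all add: dx_def dy_def)
  have flat_add: "flat (\<lambda>x y e. \<psi> x y e + \<theta> x y e)" if "flat \<psi>" "flat \<theta>" for \<psi> \<theta>
    using that parameter_poly.add unfolding flat_def by (simp add: dadd)
  have flat_scale: "flat (\<lambda>x y e. \<psi> x y e * \<theta> x y e)" if "parameter_poly \<psi>" "flat \<theta>" for \<psi> \<theta>
    using that parameter_poly.mult unfolding flat_def by (simp add: dmult)
  have flat_mult: "flat (\<lambda>x y e. \<psi> x y e * \<theta> x y e)"
    if "parameter_poly \<psi>" "parameter_poly \<theta>" "\<psi> x y e = 0" "\<theta> x y e = 0" for \<psi> \<theta>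
    using that parameter_poly.mult unfolding flat_def by (simp add: dmult)
  note P = parameter_poly.coeff[OF f] parameter_poly.coeff[OF g]
        parameter_poly.coeff[OF smooth2_on_D(1)[OF f]] parameter_poly.coeff[OF smooth2_on_D(2)[OF f]]
        parameter_poly.coeff[OF smooth2_on_D(1)[OF g]] parameter_poly.coeff[OF smooth2_on_D(2)[OF g]]
        parameter_poly.add parameter_poly.mult parameter_poly_const
  have "flat (scaled_phi f g k)"
  proof (induction k)
    case 0
    have "flat (\<lambda>x y e. f x y * (f x y * D1 g x y + (-1) * (g x y * D1 f x y)))"
      by (rule flat_mult) (intro P | simp add: eq)+
    moreover have "flat (\<lambda>x y e. f x y * (g x y * D2 g x y))"
      by (rule flat_mult) (intro P | simp add: eq)+
    moreover have "flat (\<lambda>x y e. g x y * (g x y * D2 f x y))"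
      by (rule flat_mult) (intro P | simp add: eq)+
    ultimately show ?case
      unfolding scaled_phi.simps
      by (intro flat_add flat_scale[OF parameter_poly.parameter] flat_scale[OF parameter_poly_const])
  next
    case (Suc k)
    have "flat (\<lambda>x y e. f x y * dx (scaled_phi f g k) x y e)"
      by (rule flat_mult) (use Suc eq in \<open>simp_all add: flat_def P(1) parameter_poly_gradient\<close>)
    moreover have "flat (\<lambda>x y e. g x y * dy (scaled_phi f g k) x y e)"
      by (rule flat_mult) (use Suc eq in \<open>simp_all add: flat_def P(2) parameter_poly_gradient\<close>)
    ultimately show ?case
      unfolding scaled_phi.simps by (intro flat_add flat_scale[OF parameter_poly.parameter])
  qed
  then show ?thesis by (simp add: flat_def)
qed

end

lemma flat_at_equilibrium:
  assumes "smooth2_on UNIV f" "smooth2_on UNIV g" "f x y = 0" "g x y = 0" "D2 f x y \<noteq> 0"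
    and q: "(q \<longlongrightarrow> y) (at_right 0)" and d: "(d \<longlongrightarrow> l) (at_right 0)" "l \<noteq> 0"
    and inv: "\<forall>\<^sub>F e in at_right 0. d e * f x (q e) = e * g x (q e)"
  shows "\<forall>\<^sub>F e in at_right 0. q e = y"
proof -
  obtain a where a: "\<And>z. f x z = a z * (z - y)" "isCont a y" "a y = D2 f x y"
    using smooth2_on_DERIV(2)[OF assms(1) UNIV_I, of x y] assms(3) unfolding CARAT_DERIV by auto
  obtain b where b: "\<And>z. g x z = b z * (z - y)" "isCont b y"
    using smooth2_on_DERIV(2)[OF assms(2) UNIV_I, of x y] assms(4) unfolding CARAT_DERIV by auto
  have "((\<lambda>e. d e * a (q e) - e * b (q e)) \<longlongrightarrow> l * a y - 0 * b y) (at_right 0)"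
    by (intro tendsto_diff tendsto_mult d isCont_tendsto_compose[OF a(2) q] isCont_tendsto_compose[OF b(2) q]
        tendsto_ident_at)
  then have "\<forall>\<^sub>F e in at_right 0. d e * a (q e) - e * b (q e) \<noteq> 0"
    by (rule tendsto_imp_eventually_ne) (use a(3) assms(5) d(2) in simp)
  then show ?thesis
    using inv
  proof eventually_elim
    case (elim e)
    have "(d e * a (q e) - e * b (q e)) * (q e - y) = 0"
      using elim(2) a(1) b(1) by (simp add: algebra_simps)
    then show ?case using elim(1) by simp
  qed
qed

section \<open>The slow manifold\<close>

context limit_domain
begin

lemma tame_subset:
  assumes "tame h" "limit_domain T x" "T \<subseteq> S"
  shows "limit_domain.tame T x h"
  using assms smooth2_on_subset unfolding limit_domain.tame_def[OF assms(2)] tame_def by blast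

lemma D2_pow_weighted:
  assumes "tame r" "n \<le> m"
  shows "\<exists>r'. tame r' \<and> (\<forall>(u, v)\<in>S. (D2 ^^ n) (\<lambda>u v. v ^ m * r u v) u v = v ^ (m - n) * r' u v)"
  using assms(2)
proof (induction n)
  case 0
  then show ?case using assms(1) by auto
next
  case (Suc n)
  then obtain r' where r': "tame r'"
    "\<And>u v. (u, v) \<in> S \<Longrightarrow> (D2 ^^ n) (\<lambda>u v. v ^ m * r u v) u v = v ^ (m - n) * r' u v"
    by auto
  define j where "j = m - Suc n"
  have j: "m - n = Suc j" using Suc.prems by (simp add: j_def)
  have "(D2 ^^ Suc n) (\<lambda>u v. v ^ m * r u v) u v = v ^ j * (real (Suc j) * r' u v + v * D2 r' u v)"
    if uv: "(u, v) \<in> S" for u v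
  proof -
    have "D2 ((D2 ^^ n) (\<lambda>u v. v ^ m * r u v)) u v = D2 (\<lambda>u v. v ^ Suc j * r' u v) u v"
      by (rule D_cong(2)[OF open_S uv]) (simp only: r'(2) j)
    also have "((\<lambda>s. s ^ Suc j * r' u s) has_real_derivative
        real (Suc j) * v ^ j * r' u v + D2 r' u v * v ^ Suc j) (at v)"
      using DERIV_mult[OF DERIV_pow[of "Suc j" v] smooth2_on_DERIV(2)[OF tame_smooth[OF r'(1)] uv]] by simp
    then have "D2 (\<lambda>u v. v ^ Suc j * r' u v) u v = real (Suc j) * v ^ j * r' u v + D2 r' u v * v ^ Suc j"
      unfolding D2_def by (rule DERIV_imp_deriv)
    finally show ?thesis by (simp add: algebra_simps)
  qed
  moreover have "tame (\<lambda>u v. real (Suc j) * r' u v + v * D2 r' u v)"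
    by (intro tame_add tame_mult tame_const tame_parameter tame_D r'(1))
  ultimately show ?case unfolding j_def by blast
qed

lemma D2_pow_diff:
  assumes "smooth2_on S h" "smooth2_on S j"
  shows "(u, v) \<in> S \<Longrightarrow> (D2 ^^ n) (\<lambda>u v. h u v - j u v) u v = (D2 ^^ n) h u v - (D2 ^^ n) j u v"
proof (induction n arbitrary: u v)
  case (Suc n)
  have "D2 ((D2 ^^ n) (\<lambda>u v. h u v - j u v)) u v = D2 (\<lambda>u v. (D2 ^^ n) h u v - (D2 ^^ n) j u v) u v"
    by (rule D_cong(2)[OF open_S Suc.prems]) (rule Suc.IH)
  also have "\<dots> = D2 ((D2 ^^ n) h) u v - D2 ((D2 ^^ n) j) u v"
    by (rule D_diff(2)[OF smooth2_on_pow(2)[OF assms(1)] smooth2_on_pow(2)[OF assms(2)] Suc.prems])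
  finally show ?case by simp
qed simp

lemma higher_deriv_tendsto:
  assumes "smooth2_on S A" and A: "((D2 ^^ n) A x \<longlongrightarrow> L) (at_right 0)" and "tame r" "n < m"
    and a: "\<And>u v. (u, v) \<in> S \<Longrightarrow> a u v = A u v - v ^ m * r u v"
  shows "((deriv ^^ n) (a x) \<longlongrightarrow> L) (at_right 0)"
proof -
  have "D2 h u = deriv (h u)" for h u by (simp add: D2_def fun_eq_iff)
  then have "(deriv ^^ n) (a x) = (D2 ^^ n) a x" for n
    by (induction n) simp_all
  moreover
  obtain r' where r': "tame r'"
    "\<And>u v. (u, v) \<in> S \<Longrightarrow> (D2 ^^ n) (\<lambda>u v. v ^ m * r u v) u v = v ^ (m - n) * r' u v"
    using D2_pow_weighted[OF assms(3), of n m] assms(4) by auto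
  have "((\<lambda>v::real. v ^ (m - n)) \<longlongrightarrow> 0 ^ (m - n)) (at_right 0)"
    by (intro tendsto_power tendsto_ident_at)
  then have "(\<lambda>v::real. v ^ (m - n)) \<in> o[at_right 0](\<lambda>_. 1)"
    using assms(4) by (intro smalloI_tendsto) auto
  from landau_o.small_big_mult[OF this tame_bounded[OF r'(1)]]
  have "((\<lambda>v. v ^ (m - n) * r' x v) \<longlongrightarrow> 0) (at_right 0)"
    using smalloD_tendsto by fastforce
  from tendsto_diff[OF A this]
  have "((\<lambda>v. (D2 ^^ n) A x v - v ^ (m - n) * r' x v) \<longlongrightarrow> L) (at_right 0)" by simp
  moreover have "\<forall>\<^sub>F v in at_right 0. (D2 ^^ n) A x v - v ^ (m - n) * r' x v = (D2 ^^ n) a x v"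
    using in_S
  proof eventually_elim
    case (elim v)
    have "tame (\<lambda>u v. v ^ m)" for m :: nat
      by (induction m) (simp_all add: tame_const tame_mult tame_parameter)
    then have "smooth2_on S (\<lambda>u v. v ^ m * r u v)"
      using tame_mult assms(3) tame_smooth by blast
    from D2_pow_diff[OF assms(1) this elim]
    have "(D2 ^^ n) (\<lambda>u v. A u v - v ^ m * r u v) x v = (D2 ^^ n) A x v - v ^ (m - n) * r' x v"
      by (simp only: r'(2)[OF elim])
    then show ?case
      using D_pow_cong[OF open_S a elim] by simp
  qed
  ultimately show ?thesis by (simp add: filterlim_cong)
qed

end

lemma D2_pow_monomial:
  shows "i < l \<Longrightarrow> (D2 ^^ l) (\<lambda>x e. c x * e ^ i) = (\<lambda>x e. 0)"
    and "(D2 ^^ l) (\<lambda>x e. c x * e ^ l) = (\<lambda>x e. fact l * c x)"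
proof -
  have D: "D2 (\<lambda>x e. c x * e ^ i) = (\<lambda>x e. (c x * real i) * e ^ (i - 1))" for c :: "real \<Rightarrow> real" and i
    unfolding D2_def fun_eq_iff by (auto intro!: DERIV_imp_deriv derivative_eq_intros)
  show "i < l \<Longrightarrow> (D2 ^^ l) (\<lambda>x e. c x * e ^ i) = (\<lambda>x e. 0)"
  proof (induction l arbitrary: c i)
    case (Suc l)
    show ?case
    proof (cases "i - 1 < l")
      case True
      then show ?thesis using Suc.IH by (simp add: funpow_Suc_right D del: funpow.simps)
    next
      case False
      then have "i = 0" "l = 0" using Suc.prems by auto
      then show ?thesis using D[of c 0] by simp
    qed
  qed simp
  show "(D2 ^^ l) (\<lambda>x e. c x * e ^ l) = (\<lambda>x e. fact l * c x)"
  proof (induction l arbitrary: c)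
    case (Suc l)
    show ?case
      using Suc.IH[of "\<lambda>x. c x * real (Suc l)"] D[of c "Suc l"]
      by (simp add: funpow_Suc_right mult_ac del: funpow.simps power_Suc)
  qed simp
qed

lemma D1_pow_0: "(D1 ^^ k) (\<lambda>x e. 0) = (\<lambda>x e. 0)"
  by (induction k) (simp_all add: D1_def fun_eq_iff)

locale slow_manifold =
  fixes f g F :: "real \<Rightarrow> real \<Rightarrow> real" and Fc :: "nat \<Rightarrow> real \<Rightarrow> real" and I :: "real set" and e0 x :: real
  assumes f: "smooth2_on UNIV f" and g: "smooth2_on UNIV g"
    and manifold: "slow_invariant_manifold f g I e0 F Fc"
    and x: "x \<in> I" and slope: "deriv (Fc 0) x \<noteq> 0"
begin

definition M :: "(real \<times> real) set" where
  "M = I \<times> {0<..<e0}"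

lemma F: "smooth2_on M F"
  and Fc: "\<And>n u. u \<in> I \<Longrightarrow> Fc n differentiable (at u)"
  and expansion: "has_expansion I F Fc"
  and invariance: "\<And>u v. (u, v) \<in> M \<Longrightarrow> D1 F u v * f u (F u v) = v * g u (F u v)"
  and critical: "\<And>u. u \<in> I \<Longrightarrow> f u (Fc 0 u) = 0"
  and D2_f: "D2 f x (Fc 0 x) \<noteq> 0"
  and open_I: "open I" and e0: "0 < e0"
  subgoal using manifold by (auto simp: slow_invariant_manifold_def M_def)
  subgoal for n u
  proof -
    have "(deriv ^^ 0) (Fc n) differentiable (at u)" if "u \<in> I"
      using manifold that unfolding slow_invariant_manifold_def smooth1_on_def by blast
    then show "u \<in> I \<Longrightarrow> Fc n differentiable (at u)" by simp
  qed
  using manifold x by (auto simp: slow_invariant_manifold_def M_def)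

lemma M_pos: "(u, v) \<in> M \<Longrightarrow> v > 0"
  by (simp add: M_def)

end

sublocale slow_manifold \<subseteq> limit_domain M x
proof
  show "open M" unfolding M_def by (intro open_Times open_I open_greaterThanLessThan)
  show "\<forall>\<^sub>F e in at_right 0. (x, e) \<in> M"
    using e0 x by (auto simp: M_def eventually_at_right_field)
qed

context slow_manifold
begin

lemma expansion_bigo:
  assumes "l \<le> N"
  shows "(\<lambda>e. (D1 ^^ k) ((D2 ^^ l) F) x e - (\<Sum>i<N. (D1 ^^ k) ((D2 ^^ l) (\<lambda>x e. Fc i x * e ^ i)) x e))
        \<in> O[at_right 0](\<lambda>e. e ^ (N - l))"
  using expansion assms x unfolding has_expansion_def by blast

lemma derivatives_F_bounded: "(D1 ^^ k) ((D2 ^^ l) F) x \<in> O[at_right 0](\<lambda>_. 1)"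
  using expansion_bigo[of l l k] by (simp add: D2_pow_monomial(1) D1_pow_0)

lemma derivatives_F_tendsto:
  assumes "(D1 ^^ k) (\<lambda>x e. fact l * Fc l x) = C"
    and "\<And>e. C x e = c"
  shows "((D1 ^^ k) ((D2 ^^ l) F) x \<longlongrightarrow> c) (at_right 0)"
proof -
  have "(\<lambda>e. (D1 ^^ k) ((D2 ^^ l) F) x e - c) \<in> O[at_right 0](\<lambda>e. e)"
    using expansion_bigo[of l "Suc l" k] assms by (simp add: D2_pow_monomial D1_pow_0)
  moreover have "(\<lambda>e::real. e) \<in> o[at_right 0](\<lambda>_. 1)"
    using tendsto_ident_at by (intro smalloI_tendsto) auto
  ultimately have "(\<lambda>e. (D1 ^^ k) ((D2 ^^ l) F) x e - c) \<in> o[at_right 0](\<lambda>_. 1)"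
    by (rule landau_o.big_small_trans)
  from smalloD_tendsto[OF this] show ?thesis
    by (simp add: LIM_zero_iff)
qed

lemma D2_pow_F_tendsto: "((D2 ^^ n) F x \<longlongrightarrow> fact n * Fc n x) (at_right 0)"
  using derivatives_F_tendsto[of 0 n] by simp

lemma D2_pow_D1_F_tendsto: "((D2 ^^ n) (D1 F) x \<longlongrightarrow> fact n * deriv (Fc n) x) (at_right 0)"
proof -
  have "deriv (\<lambda>u. fact n * Fc n u) x = fact n * deriv (Fc n) x"
    using Fc[OF x, of n] by (intro DERIV_imp_deriv DERIV_cmult) (simp add: DERIV_deriv_iff_real_differentiable)
  then have "(D1 ((D2 ^^ n) F) x \<longlongrightarrow> fact n * deriv (Fc n) x) (at_right 0)"
    using derivatives_F_tendsto[of "Suc 0" n, OF refl] by (simp add: D1_def)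
  moreover have "\<forall>\<^sub>F e in at_right 0. D1 ((D2 ^^ n) F) x e = (D2 ^^ n) (D1 F) x e"
    using in_S by eventually_elim (rule D1_D2_pow[OF open_S F])
  ultimately show ?thesis by (rule Lim_transform_eventually)
qed

lemma F_tendsto: "(F x \<longlongrightarrow> Fc 0 x) (at_right 0)"
  using D2_pow_F_tendsto[of 0] by simp

lemma D1_F_tendsto: "(D1 F x \<longlongrightarrow> deriv (Fc 0) x) (at_right 0)"
  using D2_pow_D1_F_tendsto[of 0] by simp

lemma tame_F: "tame F"
proof -
  have "bounded_jet m x ((D1 ^^ k) ((D2 ^^ l) F))" for m k l
  proof (induction m arbitrary: k l)
    case 0
    show ?case using derivatives_F_bounded by simp
  next
    case (Suc m)
    have "bounded_jet m x (D1 ((D1 ^^ k) ((D2 ^^ l) F)))"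
      using Suc.IH[of "Suc k" l] by simp
    moreover have "bounded_jet m x ((D1 ^^ k) (D2 ((D2 ^^ l) F)))"
      using Suc.IH[of k "Suc l"] by simp
    then have "bounded_jet m x (D2 ((D1 ^^ k) ((D2 ^^ l) F)))"
      by (rule bounded_jet_cong) (rule D2_D1_pow[OF open_S smooth2_on_pow(2)[OF F], symmetric])
    ultimately show ?case using derivatives_F_bounded by simp
  qed
  from this[of _ 0 0] show ?thesis using F by (simp add: tame_def)
qed

definition U :: "real \<Rightarrow> real \<Rightarrow> real" where
  "U u v = f u (F u v) / v"

definition G :: "real \<Rightarrow> real \<Rightarrow> real" where
  "G u v = g u (F u v)"

lemma D1_F_U: "(u, v) \<in> M \<Longrightarrow> D1 F u v * U u v = G u v"
  using invariance[of u v] M_pos[of u v] by (simp add: U_def G_def field_simps)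

lemma tame_G: "tame G"
  unfolding G_def by (rule tame_compose[OF tame_F F_tendsto g])

lemma tame_U: "tame U"
proof -
  have "smooth2_on M (\<lambda>u v. f u (F u v) * inverse v)"
    by (rule smooth2_on_mult[OF open_S smooth2_on_compose[OF open_S f F]
          smooth2_on_inverse[OF open_S _ smooth2_on_proj(2)[OF open_S]]]) (use M_pos in force)
  then have "smooth2_on M U" by (simp add: U_def[abs_def] divide_inverse)
  from tame_quotient[OF tame_D(1)[OF tame_F] D1_F_tendsto slope tame_G this D1_F_U]
  show ?thesis .
qed

definition W :: "nat \<Rightarrow> real \<Rightarrow> real \<Rightarrow> real" where
  "W k u v = phi f g (Suc k) u (F u v) v"

lemma D_W:
  assumes "(u, v) \<in> M"
  shows "D1 (W k) u v = dx (phi f g (Suc k)) u (F u v) v + dy (phi f g (Suc k)) u (F u v) v * D1 F u v"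
    and "D2 (W k) u v = de (phi f g (Suc k)) u (F u v) v + dy (phi f g (Suc k)) u (F u v) v * D2 F u v"
proof -
  have v: "v \<noteq> 0" using M_pos[OF assms] by simp
  note D = smooth2_on_DERIV[OF F assms]
  show "D1 (W k) u v = dx (phi f g (Suc k)) u (F u v) v + dy (phi f g (Suc k)) u (F u v) v * D1 F u v"
    using DERIV_imp_deriv[OF DERIV_phi[OF f g, where p = "\<lambda>t. t" and q = "\<lambda>t. F t v" and r = "\<lambda>t. v",
          OF v DERIV_ident D(1) DERIV_const]]
    by (simp add: D1_def W_def)
  show "D2 (W k) u v = de (phi f g (Suc k)) u (F u v) v + dy (phi f g (Suc k)) u (F u v) v * D2 F u v"
    using DERIV_imp_deriv[OF DERIV_phi[OF f g, where p = "\<lambda>t. u" and q = "\<lambda>t. F u t" and r = "\<lambda>t. t",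
          OF v DERIV_const D(2) DERIV_ident]]
    by (simp add: D2_def W_def)
qed

text \<open>On the invariant graph the flow is \<open>x' = U\<close>, with \<open>U\<close> bounded as \<open>e\<close> tends to \<open>0\<close>. Hence the
  singular factors \<open>1 / e\<close> in \<open>phi\<close> cancel there.\<close>

lemma tame_W: "tame (W k)"
proof (induction k)
  case 0
  have "tame (\<lambda>u v. U u v * (U u v * D1 G u v) - G u v * (U u v * D1 U u v))"
    by (intro tame_diff tame_mult tame_D tame_U tame_G)
  then show ?case
  proof (rule tame_cong)
    fix u v assume uv: "(u, v) \<in> M"
    let ?y = "F u v"
    have v: "v \<noteq> 0" using M_pos[OF uv] by simp
    have DG: "D1 G u v = D1 g u ?y + D2 g u ?y * D1 F u v"
      using D_compose(1)[OF g F uv] by (simp add: G_def[abs_def])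
    have "D1 U u v = D1 (\<lambda>u v. f u (F u v)) u v / v"
      unfolding U_def[abs_def] D1_def
      using DERIV_imp_deriv[OF DERIV_cdivide[OF smooth2_on_DERIV(1)[OF smooth2_on_compose[OF open_S f F] uv], of v]]
      by (simp add: D1_def)
    then have DU: "D1 U u v = (D1 f u ?y + D2 f u ?y * D1 F u v) / v"
      using D_compose(1)[OF f F uv] by simp
    have "W 0 u v = U u v * (U u v * D1 g u ?y + G u v * D2 g u ?y)
        - G u v * (U u v * (D1 f u ?y / v) + G u v * (D2 f u ?y / v))"
      unfolding W_def U_def G_def by (rule phi_1[OF f g v])
    then show "U u v * (U u v * D1 G u v) - G u v * (U u v * D1 U u v) = W 0 u v"
      unfolding DG DU D1_F_U[OF uv, symmetric] using v by (simp add: field_simps)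
  qed
next
  case (Suc k)
  have "tame (\<lambda>u v. U u v * D1 (W k) u v)"
    by (intro tame_mult tame_D tame_U Suc)
  then show ?case
  proof (rule tame_cong)
    fix u v assume uv: "(u, v) \<in> M"
    have "W (Suc k) u v = U u v * dx (phi f g (Suc k)) u (F u v) v + G u v * dy (phi f g (Suc k)) u (F u v) v"
      by (simp add: W_def U_def G_def phi_def time_deriv_def)
    then show "U u v * D1 (W k) u v = W (Suc k) u v"
      by (simp add: D_W(1)[OF uv] D1_F_U[OF uv, symmetric] algebra_simps)
  qed
qed

definition P :: "nat \<Rightarrow> real \<Rightarrow> real \<Rightarrow> real" where
  "P k u v = dy (scaled_phi f g k) u (F u v) v"

lemma tame_P: "tame (P k)"
  unfolding P_def
  by (rule tame_parameter_poly[OF tame_F F_tendsto parameter_poly_gradient(3)[OF parameter_poly_scaled_phi[OF f g]]])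

lemma dy_phi_P: "(u, v) \<in> M \<Longrightarrow> dy (phi f g (Suc k)) u (F u v) v = P k u v / v ^ (k + 2)"
  using dy_phi[OF f g, of v k u "F u v"] M_pos[of u v] by (simp add: P_def)

lemma D1_f: "D1 f x (Fc 0 x) = - (D2 f x (Fc 0 x) * deriv (Fc 0) x)"
proof -
  have "((\<lambda>u. f u (Fc 0 u)) has_real_derivative
      D1 f x (Fc 0 x) * 1 + D2 f x (Fc 0 x) * deriv (Fc 0) x) (at x)"
    using Fc[OF x, of 0]
    by (intro DERIV_compose2[OF f] DERIV_ident) (simp add: DERIV_deriv_iff_real_differentiable)
  moreover have "((\<lambda>u. f u (Fc 0 u)) has_real_derivative 0) (at x)"
  proof (rule DERIV_cong_ev[THEN iffD2, OF refl _ refl DERIV_const])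
    show "\<forall>\<^sub>F u in nhds x. f u (Fc 0 u) = 0"
      using eventually_nhds_in_open[OF open_I x] by eventually_elim (rule critical)
  qed
  ultimately show ?thesis using DERIV_unique by fastforce
qed

lemma P_tendsto:
  "(P k x \<longlongrightarrow> - (D2 f x (Fc 0 x) * g x (Fc 0 x) * D1 f x (Fc 0 x) ^ Suc k)) (at_right 0)"
  unfolding P_def dy_scaled_phi_0[OF f g critical[OF x], symmetric]
  by (rule parameter_poly_tendsto[OF F_tendsto tendsto_ident_at
        parameter_poly_gradient(3)[OF parameter_poly_scaled_phi[OF f g]]])

text \<open>If \<open>g\<close> vanished too, the graph would pass through an equilibrium over \<open>x\<close>, where the
  gradient of every \<open>phi f g i\<close> vanishes.\<close>

lemma g_nonzero:
  assumes "\<forall>\<^sub>F e in at_right 0. dy (phi f g (Suc k)) x (F x e) e \<noteq> 0"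
  shows "g x (Fc 0 x) \<noteq> 0"
proof
  assume g0: "g x (Fc 0 x) = 0"
  have "\<forall>\<^sub>F e in at_right 0. D1 F x e * f x (F x e) = e * g x (F x e)"
    using in_S by eventually_elim (rule invariance)
  from flat_at_equilibrium[OF f g critical[OF x] g0 D2_f F_tendsto D1_F_tendsto slope this]
  have "\<forall>\<^sub>F e in at_right 0. F x e = Fc 0 x" .
  with assms in_S have "\<forall>\<^sub>F e in at_right (0::real). False"
  proof eventually_elim
    case (elim e)
    then show ?case
      using dy_phi_P[OF elim(2)] gradient_scaled_phi_equilibrium[OF f g critical[OF x] g0] by (simp add: P_def)
  qed
  then show False by (simp add: trivial_limit_at_right_real)
qed

lemma slope_expansion:
  assumes nz: "\<forall>\<^sub>F e in at_right 0. dy (phi f g (Suc k)) x (F x e) e \<noteq> 0"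
    and "smooth2_on M A" "((D2 ^^ n) A x \<longlongrightarrow> L) (at_right 0)" "tame h" "n < k + 2"
    and a: "\<And>u v. (u, v) \<in> M \<Longrightarrow> dy (phi f g (Suc k)) u (F u v) v \<noteq> 0 \<Longrightarrow>
      a u v = A u v - h u v / dy (phi f g (Suc k)) u (F u v) v"
  shows "((deriv ^^ n) (a x) \<longlongrightarrow> L) (at_right 0)"
proof -
  define S where "S = {(u, v) \<in> M. P k u v \<noteq> 0}"
  have sub: "S \<subseteq> M" by (auto simp: S_def)
  have "continuous_on M (\<lambda>(u, v). P k u v)"
    using tame_smooth[OF tame_P] unfolding smooth2_on_def using Ck_on.simps(1)[of M] by blast
  from continuous_open_preimage[OF this open_S open_Compl[OF closed_singleton[of 0]]]
  have "open S" by (simp add: S_def vimage_def Int_def split_beta')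
  moreover have "\<forall>\<^sub>F e in at_right 0. (x, e) \<in> S"
    using nz in_S by eventually_elim (use dy_phi_P[of x _ k] in \<open>auto simp: S_def\<close>)
  ultimately interpret S: limit_domain S x by unfold_locales
  have P: "S.tame (P k)" and h: "S.tame h"
    using tame_subset[OF tame_P S.limit_domain_axioms sub] tame_subset[OF assms(4) S.limit_domain_axioms sub] .
  have ne: "P k u v \<noteq> 0" if "(u, v) \<in> S" for u v using that by (simp add: S_def)
  have r: "S.tame (\<lambda>u v. h u v * inverse (P k u v))"
  proof (rule S.tame_quotient[OF P P_tendsto _ h])
    show "- (D2 f x (Fc 0 x) * g x (Fc 0 x) * D1 f x (Fc 0 x) ^ Suc k) \<noteq> 0"
      using D2_f slope g_nonzero[OF nz] by (simp add: D1_f)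
    show "smooth2_on S (\<lambda>u v. h u v * inverse (P k u v))"
      by (intro smooth2_on_mult smooth2_on_inverse S.open_S S.tame_smooth h P ne)
    show "P k u v * (h u v * inverse (P k u v)) = h u v" if "(u, v) \<in> S" for u v
      using ne[OF that] by simp
  qed
  show ?thesis
  proof (rule S.higher_deriv_tendsto[OF smooth2_on_subset[OF assms(2) sub] assms(3) r assms(5)])
    fix u v assume uv: "(u, v) \<in> S"
    then have M: "(u, v) \<in> M" using sub by blast
    have "dy (phi f g (Suc k)) u (F u v) v \<noteq> 0"
      using dy_phi_P[OF M, of k] ne[OF uv] M_pos[OF M] by simp
    from a[OF M this] show "a u v = A u v - v ^ (k + 2) * (h u v * inverse (P k u v))"
      using M_pos[OF M] by (simp add: dy_phi_P[OF M] field_simps)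
  qed
qed

lemma a10_tendsto:
  assumes "\<forall>\<^sub>F e in at_right 0. dy (phi f g (Suc k)) x (F x e) e \<noteq> 0" "n < k + 2"
  shows "((\<lambda>e. 1 / fact n * (deriv ^^ n) (a10 f g F (Suc k) x) e) \<longlongrightarrow> deriv (Fc n) x) (at_right 0)"
proof -
  have "((deriv ^^ n) (a10 f g F (Suc k) x) \<longlongrightarrow> fact n * deriv (Fc n) x) (at_right 0)"
  proof (rule slope_expansion[OF assms(1) smooth2_on_D(1)[OF F] D2_pow_D1_F_tendsto tame_D(1)[OF tame_W[of k]] assms(2)])
    fix u v assume "(u, v) \<in> M" "dy (phi f g (Suc k)) u (F u v) v \<noteq> 0"
    then show "a10 f g F (Suc k) u v = D1 F u v - D1 (W k) u v / dy (phi f g (Suc k)) u (F u v) v"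
      by (simp add: a10_def D_W(1) field_simps)
  qed
  from tendsto_mult[OF tendsto_const[of "1 / fact n"] this] show ?thesis by simp
qed

lemma a01_tendsto:
  assumes "\<forall>\<^sub>F e in at_right 0. dy (phi f g (Suc k)) x (F x e) e \<noteq> 0"
  shows "((\<lambda>e. 1 / fact (Suc k) * (deriv ^^ k) (a01 f g F (Suc k) x) e) \<longlongrightarrow> Fc (Suc k) x) (at_right 0)"
proof -
  have "((D2 ^^ k) (D2 F) x \<longlongrightarrow> fact (Suc k) * Fc (Suc k) x) (at_right 0)"
    using D2_pow_F_tendsto[of "Suc k"] by (simp add: funpow_Suc_right del: funpow.simps fact_Suc)
  then have "((deriv ^^ k) (a01 f g F (Suc k) x) \<longlongrightarrow> fact (Suc k) * Fc (Suc k) x) (at_right 0)"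
  proof (rule slope_expansion[OF assms smooth2_on_D(2)[OF F] _ tame_D(2)[OF tame_W[of k]]])
    fix u v assume "(u, v) \<in> M" "dy (phi f g (Suc k)) u (F u v) v \<noteq> 0"
    then show "a01 f g F (Suc k) u v = D2 F u v - D2 (W k) u v / dy (phi f g (Suc k)) u (F u v) v"
      by (simp add: a01_def D_W(2) field_simps)
  qed simp
  from tendsto_mult[OF tendsto_const[of "1 / fact (Suc k)"] this] show ?thesis by (simp del: fact_Suc)
qed

end

theorem proposition7:
  fixes f g F :: "real \<Rightarrow> real \<Rightarrow> real"
    and Fc :: "nat \<Rightarrow> real \<Rightarrow> real"
    and I :: "real set"
    and e0 x :: real
  assumes "smooth2_on UNIV f" and "smooth2_on UNIV g"
    and "slow_invariant_manifold f g I e0 F Fc"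
    and "x \<in> I" and "deriv (Fc 0) x \<noteq> 0"
  shows "(\<forall>n i. i = max n 1 \<longrightarrow>
           (\<forall>\<^sub>F e in at_right 0. dy (phi f g i) x (F x e) e \<noteq> 0) \<longrightarrow>
           ((\<lambda>e. 1 / fact n * (deriv ^^ n) (\<lambda>e. a10 f g F i x e) e)
              \<longlongrightarrow> deriv (Fc n) x) (at_right 0))
       \<and> (\<forall>n\<ge>1. (\<forall>\<^sub>F e in at_right 0. dy (phi f g n) x (F x e) e \<noteq> 0) \<longrightarrow>
           ((\<lambda>e. 1 / fact n * (deriv ^^ (n - 1)) (\<lambda>e. a01 f g F n x e) e)
              \<longlongrightarrow> Fc n x) (at_right 0))"
proof -
  interpret slow_manifold f g F Fc I e0 x
    using assms by unfold_locales
  show ?thesis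
  proof (intro conjI allI impI, goal_cases)
    case (1 n i)
    then show ?case using a10_tendsto[of "i - 1" n] by simp
  next
    case (2 n)
    then show ?case using a01_tendsto[of "n - 1"] by simp
  qed
qed

end
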